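(* Let $q=2^f$ with $f\ge 4$, let $q_0$ be a power of $2$ with $q_0<q$, and assume that $\gcd(q-1,q_0^2-1)=1$. Then: (i) for every $u\in\mathbb{F}_q$, the graph $\Gamma_u=\mathrm{Cay}(K,\Omega_u\cup\Omega_{u+1})$ is a connected Cayley graph; (ii) if, in addition, $u\in\mathscr{U}_{q,q_0}$, then $\mathrm{Aut}(\Gamma_u)=G$, i.e. the full automorphism group of $\Gamma_u$ is exactly the permutation group induced by $G$ on $K$; in particular $G$ has a graphical Frobenius representation on $\Gamma_u$.
   Context: For $a,c\in\mathbb{F}_q$ and $\lambda\in\mathbb{F}_q^*$ let $\Phi_{a,c}=\begin{bmatrix}1&0&0\\ a&1&0\\ c&a^{q_0}&1\end{bmatrix}$ and $\Psi_\lambda=\mathrm{diag}(1,\lambda,\lambda^{q_0+1})$. Let $K=\{\Phi_{a,c}: a,c\in\mathbb{F}_q\}$ (a group of order $q^2$), $H=\{\Psi_\lambda:\lambda\in\mathbb{F}_q^*\}$ (cyclic of order $q-1$, normalizing $K$), and $G=HK\le GL(3,\mathbb{F}_q)$. For $u\in\mathbb{F}_q$ let $\Omega_u=\{\Phi_{a,ua^{q_0+1}}: a\in\mathbb{F}_q^*\}$. The Cayley graph $\Gamma_u=\mathrm{Cay}(K,\Omega_u\cup\Omega_{u+1})$ has vertex set $K$, with $x,y$ adjacent iff $xy^{-1}\in\Omega_u\cup\Omega_{u+1}$ (this set is inverse-closed, and the graph is simple and undirected). $G$ acts on $K$: elements of $K$ act by right multiplication and $\Psi\in H$ acts by conjugation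 $x\mapsto \Psi^{-1}x\Psi$; $G$ is identified with this permutation group on $K$, which is a group of automorphisms of $\Gamma_u$ acting as a Frobenius group with kernel $K$ and point stabilizer $H$. A group has a graphical Frobenius representation on a graph if it is isomorphic to the full automorphism group of the graph and acts on the vertices as a Frobenius group. $\mathscr{U}_{q,q_0}$ is the set of $u\in\mathbb{F}_q$ such that (U1) $u=(1+\eta^{q_0})/(\eta+\eta^{q_0})$ for some primitive element $\eta$ of $\mathbb{F}_q$, and (U2) the polynomial $X^{q_0+1}+uX^{q_0}+(u+1)X+1$ has no roots in $\mathbb{F}_q$. *)

theory Defs
  imports "HOL-Analysis.Analysis"
begin

text \<open>The field F_q is a finite field type 'a; q0 is a natural number exponent
  (a power of 2), so a^q0 is the Frobenius-type power a^(q0).\<close>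

definition Phi :: "nat \<Rightarrow> 'a::field \<Rightarrow> 'a \<Rightarrow> 'a^3^3" where
  "Phi q0 a c = vector [vector [1, 0, 0], vector [a, 1, 0], vector [c, a ^ q0, 1]]"

definition Psi :: "nat \<Rightarrow> 'a::field \<Rightarrow> 'a^3^3" where
  "Psi q0 l = vector [vector [1, 0, 0], vector [0, l, 0], vector [0, 0, l ^ (q0 + 1)]]"

definition Kgrp :: "nat \<Rightarrow> (('a::field)^3^3) set" where
  "Kgrp q0 = {Phi q0 a c | a c. True}"

definition Hgrp :: "nat \<Rightarrow> (('a::field)^3^3) set" where
  "Hgrp q0 = {Psi q0 l | l. l \<noteq> 0}"

definition Omega :: "nat \<Rightarrow> 'a::field \<Rightarrow> ('a^3^3) set" where
  "Omega q0 u = {Phi q0 a (u * a ^ (q0 + 1)) | a. a \<noteq> 0}"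

text \<open>Cayley graph Cay(K, S): x ~ y iff x y^{-1} \<in> S.\<close>
definition cay_adj :: "(('a::field)^3^3) set \<Rightarrow> ('a^3^3) set \<Rightarrow> 'a^3^3 \<Rightarrow> 'a^3^3 \<Rightarrow> bool" where
  "cay_adj V S x y \<longleftrightarrow> x \<in> V \<and> y \<in> V \<and> x ** matrix_inv y \<in> S"

definition Gamma_adj :: "nat \<Rightarrow> 'a::field \<Rightarrow> 'a^3^3 \<Rightarrow> 'a^3^3 \<Rightarrow> bool" where
  "Gamma_adj q0 u = cay_adj (Kgrp q0) (Omega q0 u \<union> Omega q0 (u + 1))"

definition graph_connected :: "'v set \<Rightarrow> ('v \<Rightarrow> 'v \<Rightarrow> bool) \<Rightarrow> bool" where
  "graph_connected V E \<longleftrightarrow> (\<forall>x\<in>V. \<forall>y\<in>V. (x, y) \<in> {(a, b). a \<in> V \<and> b \<in> V \<and> E a b}\<^sup>*)"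

text \<open>Full automorphism group of a graph (V,E), as permutations of V
  (extended by the identity outside V).\<close>
definition graph_aut :: "'v set \<Rightarrow> ('v \<Rightarrow> 'v \<Rightarrow> bool) \<Rightarrow> ('v \<Rightarrow> 'v) set" where
  "graph_aut V E = {\<sigma>. bij_betw \<sigma> V V \<and> (\<forall>x. x \<notin> V \<longrightarrow> \<sigma> x = x) \<and>
     (\<forall>x\<in>V. \<forall>y\<in>V. E x y \<longleftrightarrow> E (\<sigma> x) (\<sigma> y))}"

text \<open>The permutation group induced by G = HK on K: k \<in> K acts by right
  multiplication and \<Psi> \<in> H by conjugation x \<mapsto> \<Psi>^{-1} x \<Psi>.\<close>
definition G_perm :: "nat \<Rightarrow> (('a::field)^3^3 \<Rightarrow> 'a^3^3) set" where
  "G_perm q0 = {(\<lambda>x. if x \<in> Kgrp q0 then matrix_inv h ** (x ** k) ** h else x) | h k.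
       h \<in> Hgrp q0 \<and> k \<in> Kgrp q0}"

text \<open>A permutation group P on V acts as a Frobenius group: transitive, not regular
  (some nonidentity element fixes a point), and every nonidentity element fixes at
  most one point.\<close>
definition frobenius_action :: "('v \<Rightarrow> 'v) set \<Rightarrow> 'v set \<Rightarrow> bool" where
  "frobenius_action P V \<longleftrightarrow>
     (\<forall>x\<in>V. \<forall>y\<in>V. \<exists>g\<in>P. g x = y) \<and>
     (\<exists>g\<in>P. (\<exists>x\<in>V. g x \<noteq> x) \<and> (\<exists>x\<in>V. g x = x)) \<and>
     (\<forall>g\<in>P. (\<exists>x\<in>V. g x \<noteq> x) \<longrightarrow> card {x\<in>V. g x = x} \<le> 1)"

definition primitive_elem :: "'a::field \<Rightarrow> bool" where
  "primitive_elem \<eta> \<longleftrightarrow> \<eta> \<noteq> 0 \<and> (\<forall>x. x \<noteq> 0 \<longrightarrow> (\<exists>n::nat. \<eta> ^ n = x))"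

definition U_set :: "nat \<Rightarrow> 'a::field set" where
  "U_set q0 = {u. (\<exists>\<eta>. primitive_elem \<eta> \<and> u = (1 + \<eta> ^ q0) / (\<eta> + \<eta> ^ q0)) \<and>
                  (\<forall>x. x ^ (q0 + 1) + u * x ^ q0 + (u + 1) * x + 1 \<noteq> 0)}"

end

(*
The arcs x -> g x with g in Omega_u orient the graph. The neighbourhood of 1 consists of the
out-neighbours X_a and the in-neighbours Y_a (a nonzero), and, by (U1) and (U2), its induced subgraph
is a generalized Petersen graph: X_a ~ X_{eta a}, Y_a ~ Y_{zeta a} with zeta = 1 + 1/eta, and
spokes X_a ~ Y_a (after rescaling Y by 1 + eta). Since eta is primitive, no short multiplicative
relation holds between eta and zeta, so a path of length 2 lies on a closed walk of length 8 without
backtracking iff it contains a spoke. Hence an automorphism fixing 1 preserves or exchanges the two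
rims, and by connectedness every automorphism preserves all arcs or reverses all arcs.

An arc-preserving automorphism fixing 1 and X_1 fixes all neighbours of 1 and then everything; this
gives G. An arc-reversing automorphism fixing 1 normalizes G, so it is an automorphism of the group K.
On the quotient of K by its centre it acts, up to a scalar, as a field automorphism mu with
mu(1/eta) = 1 + 1/eta, an involution; then q is a square, whereas f is odd because 3 divides
q0^2 - 1 and is therefore coprime to q - 1.
*)
theory Submission
  imports Defs
begin

section \<open>Power maps of finite fields\<close>

text \<open>Write s for x -> x^q0. For u as in (U1), clearing the denominator h + s(h) turns an
  adjacency between two neighbours of 1 into an equation s(x) y = x s(y), apart from arcs X_a ->
  Y_b, where the polynomial of (U2) appears. As s fixes only 0 and 1, the ratio x/y is 1, so
  adjacency becomes linear in the labels; the multipliers eta and zeta arise in this way. The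
  obstacle is that an automorphism of the neighbourhood might mix rim edges and spokes. Octagons
  separate them: those through spokes exist because multiplication by eta commutes with
  multiplication by zeta, while one around a rim path requires a relation between small powers of
  eta and zeta. After square and cube roots are taken, eta zeta = 1 + eta turns such a relation into
  a polynomial equation of degree at most 6 over F_2 whose roots lie in F_64 or F_16. This is the
  origin of the exponents 63 and 15. Primitivity is known for eta only, so the inner rim may consist
  of several cycles; the argument relies on the connectedness of the outer one.\<close>

lemma finite_field_power_card:
  fixes x :: "'a::{field,finite}"
  assumes "x \<noteq> 0"
  shows "x ^ (CARD('a) - 1) = 1"
proof -
  have "bij_betw ((*) x) (UNIV - {0}) (UNIV - {0})"
    by (rule bij_betwI[of _ _ _ "\<lambda>y. y / x"]) (use assms in auto)
  hence "(\<Prod>y\<in>UNIV - {0}. x * y) = (\<Prod>y\<in>UNIV - {0::'a}. y)"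
    by (rule prod.reindex_bij_betw)
  moreover have "(\<Prod>y\<in>UNIV - {0::'a}. y) \<noteq> 0" by simp
  ultimately show ?thesis by (simp add: prod.distrib card_Diff_singleton)
qed

lemma finite_field_power_eq_one:
  fixes x :: "'a::{field,finite}"
  assumes "coprime m (CARD('a) - 1)" "x ^ m = 1" "x \<noteq> 0"
  shows "x = 1"
proof (cases "m = 0")
  case True
  with assms(1) have "CARD('a) - 1 = 1" by simp
  with finite_field_power_card[OF assms(3)] show ?thesis by (metis power_one_right)
next
  case False
  from bezout_nat[OF this, of "CARD('a) - 1"] assms(1)
  obtain i j where "m * i = (CARD('a) - 1) * j + 1" by auto
  hence "(x ^ m) ^ i = (x ^ (CARD('a) - 1)) ^ j * x"
    by (simp flip: power_mult)
  then show ?thesis using assms(2) finite_field_power_card[OF assms(3)] by simp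
qed

lemma finite_field_power_inj:
  fixes x y :: "'a::{field,finite}"
  assumes "coprime m (CARD('a) - 1)" "m > 0" "x ^ m = y ^ m"
  shows "x = y"
proof (cases "y = 0")
  case True
  then show ?thesis using assms(2,3) by (simp add: power_0_left)
next
  case False
  then have "x \<noteq> 0" using assms(2,3) by (metis power_eq_0_iff)
  have "(x / y) ^ m = 1" using assms(3) False by (simp add: power_divide)
  from finite_field_power_eq_one[OF assms(1) this] False \<open>x \<noteq> 0\<close> show ?thesis by simp
qed

lemma finite_field_power_surj:
  fixes c :: "'a::{field,finite}"
  assumes "coprime m (CARD('a) - 1)" "m > 0"
  shows "\<exists>d. d ^ m = c"
proof -
  have "inj (\<lambda>d::'a. d ^ m)"
    using finite_field_power_inj[OF assms] by (rule injI)
  from finite_UNIV_inj_surj[OF _ this] show ?thesis by (metis finite_class.finite_UNIV surjD)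
qed

lemma primitive_elem_order:
  fixes h :: "'a::{field,finite}"
  assumes "primitive_elem h" "h ^ m = 1" "m > 0"
  shows "CARD('a) - 1 \<le> m"
proof -
  have "UNIV - {0} \<subseteq> (\<lambda>i. h ^ i) ` {..<m}"
  proof
    fix x :: 'a assume "x \<in> UNIV - {0}"
    then obtain n where n: "h ^ n = x" using assms(1) by (auto simp: primitive_elem_def)
    have "h ^ n = (h ^ m) ^ (n div m) * h ^ (n mod m)" by (simp flip: power_mult power_add)
    with n assms show "x \<in> (\<lambda>i. h ^ i) ` {..<m}" by auto
  qed
  hence "card (UNIV - {0::'a}) \<le> card ((\<lambda>i. h ^ i) ` {..<m})" by (intro card_mono) auto
  also have "\<dots> \<le> m" using card_image_le[of "{..<m}" "\<lambda>i. h ^ i"] by simp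
  finally show ?thesis by (simp add: card_Diff_singleton)
qed

text \<open>With exponent e it shows that 3 divides q0^2 - 1, so cubing is injective on the field;
  for even f, exponent f/2 would make 3 divide q - 1 as well.\<close>

lemma three_dvd_four_power: "3 dvd (4 ^ n - 1 :: nat)"
proof -
  have "4 ^ n mod 3 = (1 :: nat)" by (induction n) (simp_all add: mod_mult_eq[symmetric, of 4])
  then show ?thesis by (metis dvd_minus_mod)
qed

text \<open>The unit group has odd order q - 1, so the power of -1 with this exponent is both -1 and
  1.\<close>

lemma char_two_of_even_card:
  assumes "even CARD('a::{field,finite})"
  shows "1 + 1 = (0::'a)"
proof -
  have "odd (CARD('a) - 1)" using assms by (simp add: card_gt_0_iff)
  with finite_field_power_card[of "-1::'a"] have "-1 = (1::'a)" by simp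
  then show ?thesis by (metis add.right_inverse)
qed

lemma frobenius_power_add:
  fixes x y :: "'a::field"
  assumes "1 + 1 = (0::'a)"
  shows "(x + y) ^ (2 ^ n) = x ^ (2 ^ n) + y ^ (2 ^ n)"
proof (induction n)
  case (Suc n)
  have "2 = (0::'a)" using assms by simp
  have "(x + y) ^ (2 ^ Suc n) = (x ^ (2 ^ n) + y ^ (2 ^ n))\<^sup>2"
    by (simp add: Suc mult.commute[of 2] power_mult)
  also have "\<dots> = (x ^ (2 ^ n))\<^sup>2 + (y ^ (2 ^ n))\<^sup>2"
    by (simp add: power2_sum \<open>2 = (0::'a)\<close>)
  finally show ?case by (simp add: mult.commute[of 2] power_mult)
qed simp

section \<open>The group and its Cayley graph in coordinates\<close>

text \<open>\<open>s\<close> abstracts x -> x^q0. The last three assumptions carry the coprimality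
  hypothesis: the factor q0 - 1 leaves \<open>s\<close> only the fixed points 0 and 1, and the
  factor q0 + 1 makes x -> \<open>s x * x\<close> bijective.\<close>

locale frobenius_like =
  fixes s :: "'a::{field,finite} \<Rightarrow> 'a"
  assumes two: "1 + 1 = (0::'a)"
    and s_add: "s (x + y) = s x + s y"
    and s_mult: "s (x * y) = s x * s y"
    and s_fixed: "s x = x \<Longrightarrow> x = 0 \<or> x = 1"
    and norm_surj: "\<exists>x. s x * x = c"
    and norm_inj: "s x * x = 1 \<Longrightarrow> x = 1"
begin

lemma numeral_two: "2 = (0::'a)" using two by simp

lemma dbl [simp]: "x + x = (0::'a)" "x + (x + y) = (y::'a)"
proof -
  have "x + x = x * (1 + 1)" by (simp only: distrib_left mult_1_right)
  then show "x + x = 0" by (simp only: two mult_zero_right)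
  then show "x + (x + y) = y" by (metis add.assoc add.left_neutral)
qed

lemma neg_char2 [simp]: "- x = (x::'a)" "x - y = (x + y :: 'a)"
  by (metis dbl(1) minus_unique) (metis add_diff_cancel_right' add.assoc dbl(1) add.right_neutral)

lemma eq_iff_add: "x = y \<longleftrightarrow> x + y = (0::'a)"
  by (metis dbl(1) dbl(2) add.right_neutral)

text \<open>Computations that keep all terms on one side, so that equal terms cancel in pairs,
  switch this rule off.\<close>

lemma add_eq_0 [simp]: "x + y = 0 \<longleftrightarrow> x = (y::'a)"
  using eq_iff_add by metis

lemma s_0 [simp]: "s 0 = 0" using s_add[of 0 0] by simp

lemma s_1 [simp]: "s 1 = 1"
proof -
  have "s 1 = s 1 * s 1" using s_mult[of 1 1] by simp
  moreover have "s 1 \<noteq> 0"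
  proof
    assume "s 1 = 0"
    hence "s x = 0" for x using s_mult[of x 1] by simp
    then show False using norm_surj[of 1] by simp
  qed
  ultimately show ?thesis by (metis mult_cancel_right1)
qed

lemma s_eq_0 [simp]: "s x = 0 \<longleftrightarrow> x = 0"
proof
  assume "s x = 0"
  show "x = 0"
  proof (rule ccontr)
    assume "x \<noteq> 0"
    hence "s x * s (1 / x) = 1" by (simp flip: s_mult)
    with \<open>s x = 0\<close> show False by simp
  qed
qed simp

lemma s_div: "s (x / y) = s x / s y"
proof (cases "y = 0")
  case False
  hence "s (x / y) * s y = s x" by (simp flip: s_mult)
  then show ?thesis using False by (simp add: field_simps)
qed simp

text \<open>The group \<open>K\<close> in coordinates: \<open>(a, c)\<close> stands for the matrix \<open>\<Phi>\<^sub>a\<^sub>,\<^sub>c\<close>.\<close>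

fun kmul :: "'a \<times> 'a \<Rightarrow> 'a \<times> 'a \<Rightarrow> 'a \<times> 'a" where
  "kmul (a, c) (b, d) = (a + b, c + d + s a * b)"

fun kinv :: "'a \<times> 'a \<Rightarrow> 'a \<times> 'a" where
  "kinv (a, c) = (a, c + s a * a)"

fun kconj :: "'a \<Rightarrow> 'a \<times> 'a \<Rightarrow> 'a \<times> 'a" where
  "kconj l (a, c) = (l * a, s l * l * c)"

lemma kmul_assoc: "kmul (kmul x y) z = kmul x (kmul y z)"
  by (cases x; cases y; cases z) (simp add: s_add algebra_simps)

lemma kmul_one [simp]: "kmul (0, 0) x = x" "kmul x (0, 0) = x"
  by (cases x; simp)+

lemma kmul_kinv [simp]: "kmul (kinv x) x = (0, 0)" "kmul x (kinv x) = (0, 0)"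
  by (cases x; simp add: algebra_simps)+

lemma kmul_kinv_cancel [simp]: "kmul (kinv x) (kmul x y) = y" "kmul x (kmul (kinv x) y) = y"
  "kmul (kmul y x) (kinv x) = y" "kmul (kmul y (kinv x)) x = y"
  by (simp_all add: kmul_assoc flip: kmul_assoc[of x] kmul_assoc[of "kinv x"])

lemma kconj_kmul: "kconj l (kmul x y) = kmul (kconj l x) (kconj l y)"
  by (cases x; cases y) (simp add: s_mult algebra_simps)

lemma kconj_kconj [simp]: "kconj l (kconj m x) = kconj (l * m) x"
  by (cases x) (simp add: s_mult algebra_simps)

lemma kconj_one [simp]: "kconj 1 x = x"
  by (cases x) simp

end

locale frobenius_graph = frobenius_like s for s :: "'a::{field,finite} \<Rightarrow> 'a" +
  fixes u :: 'a
begin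

text \<open>This is y x^{-1} in Omega_u written out, with the generator's parameter recovered as
  \<open>b + b'\<close>; adjacency is then one equation over the field.\<close>

fun arc :: "'a \<times> 'a \<Rightarrow> 'a \<times> 'a \<Rightarrow> bool" where
  "arc (b, d) (b', d') \<longleftrightarrow> b \<noteq> b' \<and> d + d' = u * (s (b + b') * (b + b')) + s (b + b') * b"

text \<open>Inverting an element of K adds \<open>s a * a\<close> to its second coordinate, so
  Omega_{u+1} is the set of inverses of Omega_u, and the two directions of \<open>arc\<close>
  account for the whole connection set.\<close>

definition edge :: "'a \<times> 'a \<Rightarrow> 'a \<times> 'a \<Rightarrow> bool" where
  "edge x y \<longleftrightarrow> arc x y \<or> arc y x"

definition outgen :: "'a \<Rightarrow> 'a \<times> 'a" where
  "outgen a = (a, u * (s a * a))"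

lemma arc_iff: "arc x y \<longleftrightarrow> (\<exists>a. a \<noteq> 0 \<and> y = kmul (outgen a) x)"
proof (cases x; cases y)
  fix b d b' d' assume [simp]: "x = (b, d)" "y = (b', d')"
  show ?thesis
  proof
    assume "arc x y"
    hence "b \<noteq> b'" and *: "d + d' = u * (s (b + b') * (b + b')) + s (b + b') * b" by auto
    have "d' = d + (d + d')" by simp
    also have "\<dots> = d + (u * (s (b + b') * (b + b')) + s (b + b') * b)" by (simp only: *)
    finally have "y = kmul (outgen (b + b')) x"
      by (simp add: outgen_def algebra_simps)
    then show "\<exists>a. a \<noteq> 0 \<and> y = kmul (outgen a) x" using \<open>b \<noteq> b'\<close> by (intro exI[of _ "b + b'"]) simp
  next
    assume "\<exists>a. a \<noteq> 0 \<and> y = kmul (outgen a) x"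
    then obtain a where "a \<noteq> 0" and y: "y = kmul (outgen a) x" by blast
    hence *: "b' = a + b" "d' = u * (s a * a) + d + s a * b" by (auto simp: outgen_def)
    have "b + b' = a" unfolding * by (simp add: add.left_commute)
    then show "arc x y" using \<open>a \<noteq> 0\<close> * by (auto simp: algebra_simps)
  qed
qed

lemma arc_kmul [simp]: "arc (kmul x z) (kmul y z) \<longleftrightarrow> arc x y"
proof -
  have "arc x y \<Longrightarrow> arc (kmul x z) (kmul y z)" for x y z
    unfolding arc_iff by (auto simp: kmul_assoc)
  from this[of x y z] this[of "kmul x z" "kmul y z" "kinv z"] show ?thesis by auto
qed

lemma arc_kconj: assumes "l \<noteq> 0" shows "arc (kconj l x) (kconj l y) \<longleftrightarrow> arc x y"
proof -
  have "arc x y \<Longrightarrow> l \<noteq> 0 \<Longrightarrow> arc (kconj l x) (kconj l y)" for x y l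
  proof -
    assume "arc x y" "l \<noteq> 0"
    then obtain a where a: "a \<noteq> 0" "y = kmul (outgen a) x" unfolding arc_iff by auto
    have "kconj l (outgen a) = outgen (l * a)" by (simp add: outgen_def s_mult)
    with a have "kconj l y = kmul (outgen (l * a)) (kconj l x)" by (simp add: kconj_kmul)
    then show ?thesis unfolding arc_iff using a \<open>l \<noteq> 0\<close> by (intro exI[of _ "l * a"]) auto
  qed
  from this[of x y l] this[of "kconj l x" "kconj l y" "1 / l"] assms show ?thesis by auto
qed

lemma arc_asym: "arc x y \<Longrightarrow> \<not> arc y x"
proof (cases x; cases y)
  fix b d b' d' assume [simp]: "x = (b, d)" "y = (b', d')" and "arc x y"
  show ?thesis
  proof
    assume "arc y x"
    with \<open>arc x y\<close> have "s (b + b') * b = s (b + b') * b'" "b \<noteq> b'"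
      by (auto simp: add.commute)
    then show False by simp
  qed
qed

lemma edge_kmul [simp]: "edge (kmul x z) (kmul y z) \<longleftrightarrow> edge x y"
  by (simp add: edge_def)

lemma edge_kconj: "l \<noteq> 0 \<Longrightarrow> edge (kconj l x) (kconj l y) \<longleftrightarrow> edge x y"
  by (simp add: edge_def arc_kconj)

text \<open>The centre is covered by the squares of the generators, as \<open>x \<mapsto> x\<^bsup>q\<^sub>0+1\<^esup>\<close> is onto.\<close>

lemma edge_connected: "edge\<^sup>*\<^sup>* x y"
proof -
  have step: "edge x (kmul (outgen a) x)" if "a \<noteq> 0" for a x
    using that by (auto simp: edge_def arc_iff)
  have central: "edge\<^sup>*\<^sup>* x (kmul (0, c) x)" for c x
  proof -
    obtain d where d: "s d * d = c" using norm_surj by auto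
    show ?thesis
    proof (cases "d = 0")
      case False
      have "kmul (outgen d) (kmul (outgen d) x) = kmul (0, c) x"
        using d by (cases x) (simp add: outgen_def s_add algebra_simps)
      with step[OF False, of x] step[OF False, of "kmul (outgen d) x"] show ?thesis
        by (metis rtranclp.rtrancl_into_rtrancl rtranclp.rtrancl_refl)
    qed (use d in simp)
  qed
  obtain a c where ac: "kmul y (kinv x) = (a, c)" by fastforce
  hence y: "y = kmul (a, c) x" by (metis kmul_kinv_cancel(4))
  show ?thesis
  proof (cases "a = 0")
    case True with y central show ?thesis by simp
  next
    case False
    have "kmul (outgen a) (kmul (0, c + u * (s a * a)) x) = y"
      unfolding y by (cases x) (simp add: outgen_def algebra_simps)
    with step[OF False, of "kmul (0, c + u * (s a * a)) x"] central[of x "c + u * (s a * a)"]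
    show ?thesis by (metis rtranclp.rtrancl_into_rtrancl)
  qed
qed

end

section \<open>Octagons in generalized Petersen graphs\<close>

text \<open>The path \<open>p, q, r\<close> extends to a closed walk of length 8 without backtracking.\<close>

definition octagon :: "('v \<Rightarrow> 'v \<Rightarrow> bool) \<Rightarrow> 'v \<Rightarrow> 'v \<Rightarrow> 'v \<Rightarrow> bool" where
  "octagon E p q r \<longleftrightarrow> (\<exists>v3 v4 v5 v6 v7.
     E p q \<and> E q r \<and> E r v3 \<and> E v3 v4 \<and> E v4 v5 \<and> E v5 v6 \<and> E v6 v7 \<and> E v7 p \<and>
     p \<noteq> r \<and> q \<noteq> v3 \<and> r \<noteq> v4 \<and> v3 \<noteq> v5 \<and> v4 \<noteq> v6 \<and> v5 \<noteq> v7 \<and> v6 \<noteq> p \<and> v7 \<noteq> q)"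

lemma octagonI:
  assumes "E p q" "E q r" "E r v3" "E v3 v4" "E v4 v5" "E v5 v6" "E v6 v7" "E v7 p"
    "p \<noteq> r" "q \<noteq> v3" "r \<noteq> v4" "v3 \<noteq> v5" "v4 \<noteq> v6" "v5 \<noteq> v7" "v6 \<noteq> p" "v7 \<noteq> q"
  shows "octagon E p q r"
  unfolding octagon_def using assms by blast

text \<open>Injectivity is asked only at vertices with an edge, because the labelling of the
  neighbours of 1 is not injective at the label 0.\<close>

lemma octagon_map:
  assumes "octagon E p q r" "inj_on f {x. \<exists>y. E x y}" "\<And>x y. E x y \<Longrightarrow> E' (f x) (f y)"
  shows "octagon E' (f p) (f q) (f r)"
proof -
  from assms(1) obtain v3 v4 v5 v6 v7 where
    "E p q" "E q r" "E r v3" "E v3 v4" "E v4 v5" "E v5 v6" "E v6 v7" "E v7 p"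
    "p \<noteq> r" "q \<noteq> v3" "r \<noteq> v4" "v3 \<noteq> v5" "v4 \<noteq> v6" "v5 \<noteq> v7" "v6 \<noteq> p" "v7 \<noteq> q"
    unfolding octagon_def by blast
  note v = this
  have "f x \<noteq> f y" if "x \<noteq> y" "E x x'" "E y y'" for x y x' y'
    using inj_onD[OF assms(2), of x y] that by blast
  note ne = this[OF v(9) v(1,3)] this[OF v(10) v(2,4)] this[OF v(11) v(3,5)] this[OF v(12) v(4,6)]
    this[OF v(13) v(5,7)] this[OF v(14) v(6,8)] this[OF v(15) v(7,1)] this[OF v(16) v(8,2)]
  show ?thesis
    by (rule octagonI[where E = E', OF v(1-8)[THEN assms(3)] ne])
qed

lemma octagon_rev:
  assumes "octagon E p q r" "\<And>x y. E x y \<Longrightarrow> E y x"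
  shows "octagon E r q p"
proof -
  from assms(1) obtain v3 v4 v5 v6 v7 where
    "E p q" "E q r" "E r v3" "E v3 v4" "E v4 v5" "E v5 v6" "E v6 v7" "E v7 p"
    "p \<noteq> r" "q \<noteq> v3" "r \<noteq> v4" "v3 \<noteq> v5" "v4 \<noteq> v6" "v5 \<noteq> v7" "v6 \<noteq> p" "v7 \<noteq> q"
    unfolding octagon_def by blast
  note v = this
  note e = v(1-8)[THEN assms(2)] and n = v(9-16)[symmetric]
  show ?thesis
    by (rule octagonI[where E = E, OF e(2,1,8,7,6,5,4,3) n(1,8,7,6,5,4,3,2)])
qed

text \<open>A generalized Petersen graph: the label \<open>True\<close> is the outer rim, \<open>False\<close> the inner one.\<close>

inductive petersen :: "'a::field \<Rightarrow> 'a \<Rightarrow> bool \<times> 'a \<Rightarrow> bool \<times> 'a \<Rightarrow> bool" for h z where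
  out: "a \<noteq> 0 \<Longrightarrow> petersen h z (True, a) (True, h * a)"
| out': "a \<noteq> 0 \<Longrightarrow> petersen h z (True, h * a) (True, a)"
| inn: "a \<noteq> 0 \<Longrightarrow> petersen h z (False, a) (False, z * a)"
| inn': "a \<noteq> 0 \<Longrightarrow> petersen h z (False, z * a) (False, a)"
| spoke: "a \<noteq> 0 \<Longrightarrow> petersen h z (i, a) (\<not> i, a)"

text \<open>The exclusions \<open>ne\<close> are what remains, after square and cube roots, of the
  possible coincidences between the ends of two half octagons. They are not symmetric in
  \<open>h\<close> and \<open>z\<close>, so the inner rim needs the locale with exchanged parameters
  as well.\<close>

locale petersen_params =
  fixes h z :: "'a::field"
  assumes nz: "h \<noteq> 0" "z \<noteq> 0"
    and sq: "\<And>x y::'a. x ^ 2 = y ^ 2 \<Longrightarrow> x = y"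
    and cube: "\<And>x y::'a. x ^ 3 = y ^ 3 \<Longrightarrow> x = y"
    and ne: "h \<noteq> 1" "h \<noteq> z" "h * z \<noteq> 1"
      "h ^ 2 \<noteq> z" "h ^ 2 * z \<noteq> 1" "h ^ 3 \<noteq> z" "h ^ 3 * z \<noteq> 1" "h ^ 5 \<noteq> z" "h ^ 5 * z \<noteq> 1"
      "z ^ 2 \<noteq> h" "z ^ 2 * h \<noteq> 1"
begin

lemma h_power_ne_1: "h ^ 2 \<noteq> 1" "h ^ 4 \<noteq> 1" "h ^ 6 \<noteq> 1" "h ^ 8 \<noteq> 1"
proof -
  show 2: "h ^ 2 \<noteq> 1" using sq[of h 1] ne by auto
  then show 4: "h ^ 4 \<noteq> 1" using sq[of "h^2" 1] by auto
  then show "h ^ 8 \<noteq> 1" using sq[of "h^4" 1] by auto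
  show "h ^ 6 \<noteq> 1" using cube[of "h^2" 1] 2 by auto
qed

lemma no_reducible_relation: "h ^ 2 \<noteq> z ^ 2" "h ^ 2 * z ^ 2 \<noteq> 1" "h ^ 4 \<noteq> z ^ 2" "h ^ 4 * z ^ 2 \<noteq> 1"
  "h ^ 2 \<noteq> z ^ 4" "h ^ 2 * z ^ 4 \<noteq> 1" "h ^ 3 \<noteq> z ^ 3" "h ^ 3 * z ^ 3 \<noteq> 1"
  using sq[of h z] sq[of "h * z" 1] sq[of "h^2" z] sq[of "h^2 * z" 1] sq[of h "z^2"]
    sq[of "h * z^2" 1] cube[of h z] cube[of "h * z" 1] ne
  by (auto simp: power_mult_distrib mult.commute)

text \<open>The ends of the walks of length 4 without backtracking that start at \<open>(True, a)\<close>
  with a rim step in one direction, respectively in the other.\<close>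

definition forward_ends where
  "forward_ends a = {(True, h^4 * a), (True, h * z * a), (True, h * a / z), (False, h^3 * a),
    (False, h^2 * z * a), (False, h^2 * a / z), (False, h * z^2 * a), (False, h * a / z^2)}"

definition backward_ends where
  "backward_ends a = {(True, a / h^4), (True, z * a / h), (True, a / (h * z)), (False, a / h^3),
    (False, z * a / h^2), (False, a / (h^2 * z)), (False, z^2 * a / h), (False, a / (h * z^2))}"

lemma petersen_iff: "petersen h z (i, a) (j, b) \<longleftrightarrow> a \<noteq> 0 \<and>
   (if i then j \<and> b = h * a \<or> j \<and> b = a / h \<or> \<not> j \<and> b = a
    else \<not> j \<and> b = z * a \<or> \<not> j \<and> b = a / z \<or> j \<and> b = a)" (is "_ \<longleftrightarrow> ?rhs")
proof -
  have "petersen h z (True, a) (True, a / h)" if "a \<noteq> 0"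
    using petersen.out'[where a="a / h" and h=h and z=z] nz that by simp
  moreover have "petersen h z (False, a) (False, a / z)" if "a \<noteq> 0"
    using petersen.inn'[where a="a / z" and h=h and z=z] nz that by simp
  moreover have "petersen h z (True, a) (False, a)" "petersen h z (False, a) (True, a)" if "a \<noteq> 0"
    using petersen.spoke[OF that, of h z True] petersen.spoke[OF that, of h z False] by simp_all
  ultimately have "?rhs \<Longrightarrow> petersen h z (i, a) (j, b)"
    by (cases i; cases j) (auto simp: petersen.out petersen.inn)
  moreover have "petersen h z (i, a) (j, b) \<Longrightarrow> ?rhs"
    by (erule petersen.cases) (use nz in auto)
  ultimately show ?thesis by blast
qed

lemma petersen_True:
  "petersen h z (True, a) v \<longleftrightarrow> a \<noteq> 0 \<and> (v = (True, h * a) \<or> v = (True, a / h) \<or> v = (False, a))"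
  by (cases v) (auto simp: petersen_iff)

lemma petersen_False:
  "petersen h z (False, a) v \<longleftrightarrow> a \<noteq> 0 \<and> (v = (False, z * a) \<or> v = (False, a / z) \<or> v = (True, a))"
  by (cases v) (auto simp: petersen_iff)

lemma forward_ends:
  assumes "a \<noteq> 0" "petersen h z (True, h * a) v3" "v3 \<noteq> (True, a)" "petersen h z v3 v4"
    "v4 \<noteq> (True, h * a)" "petersen h z v4 v5" "v5 \<noteq> v3"
  shows "v5 \<in> forward_ends a"
proof -
  from assms(2) consider "v3 = (True, h^2 * a)" | "v3 = (False, h * a)"
    using assms(1,3) nz by (auto simp: petersen_True power2_eq_square mult.assoc)
  then show ?thesis
  proof cases
    case 1
    with assms(4,5) consider "v4 = (True, h^3 * a)" | "v4 = (False, h^2 * a)"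
      using nz by (auto simp: petersen_True power2_eq_square power3_eq_cube mult.assoc)
    then show ?thesis
      by cases (use assms(1,6,7) nz 1 in \<open>auto simp: forward_ends_def petersen_True petersen_False
          power2_eq_square power3_eq_cube power4_eq_xxxx field_simps\<close>)
  next
    case 2
    with assms(4,5) consider "v4 = (False, h * z * a)" | "v4 = (False, h * a / z)"
      using nz by (auto simp: petersen_False mult_ac)
    then show ?thesis
      by cases (use assms(1,6,7) nz 2 in \<open>auto simp: forward_ends_def petersen_True petersen_False
          power2_eq_square power3_eq_cube power4_eq_xxxx field_simps\<close>)
  qed
qed

lemma backward_ends:
  assumes "a \<noteq> 0" "petersen h z (True, a / h) v3" "v3 \<noteq> (True, a)" "petersen h z v3 v4"
    "v4 \<noteq> (True, a / h)" "petersen h z v4 v5" "v5 \<noteq> v3"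
  shows "v5 \<in> backward_ends a"
proof -
  from assms(2) consider "v3 = (True, a / h^2)" | "v3 = (False, a / h)"
    using assms(1,3) nz by (auto simp: petersen_True power2_eq_square mult.assoc)
  then show ?thesis
  proof cases
    case 1
    with assms(4,5) consider "v4 = (True, a / h^3)" | "v4 = (False, a / h^2)"
      using nz by (auto simp: petersen_True power2_eq_square power3_eq_cube mult.assoc)
    then show ?thesis
      by cases (use assms(1,6,7) nz 1 in \<open>auto simp: backward_ends_def petersen_True petersen_False
          power2_eq_square power3_eq_cube power4_eq_xxxx field_simps\<close>)
  next
    case 2
    with assms(4,5) consider "v4 = (False, z * a / h)" | "v4 = (False, a / (h * z))"
      using nz by (auto simp: petersen_False mult_ac)
    then show ?thesis
      by cases (use assms(1,6,7) nz 2 in \<open>auto simp: backward_ends_def petersen_True petersen_False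
          power2_eq_square power3_eq_cube power4_eq_xxxx field_simps\<close>)
  qed
qed

text \<open>These are \<open>h ^ 3 \<noteq> z\<close> and \<open>h ^ 3 * z \<noteq> 1\<close> with a
  common factor \<open>z\<close> left in, the shape that clearing denominators produces.\<close>

lemma no_shifted_relation: "h ^ 3 * z \<noteq> z ^ 2" "h ^ 3 * z ^ 2 \<noteq> z"
proof -
  show "h ^ 3 * z \<noteq> z ^ 2" using ne(6) nz by (simp add: power2_eq_square)
  show "h ^ 3 * z ^ 2 \<noteq> z"
  proof
    assume "h ^ 3 * z ^ 2 = z"
    hence "z * (h ^ 3 * z) = z * 1" by (simp add: power2_eq_square algebra_simps)
    with nz ne(7) show False by (metis mult_left_cancel)
  qed
qed

text \<open>A common end would be a relation between powers of \<open>h\<close> and \<open>z\<close>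
  of total degree at most 8, and each of those that can occur has been excluded.\<close>

lemma ends_disjoint:
  assumes "a \<noteq> 0"
  shows "forward_ends a \<inter> backward_ends a = {}"
  unfolding forward_ends_def backward_ends_def using h_power_ne_1 no_reducible_relation no_shifted_relation ne
  by (simp add: nz assms divide_simps) (simp add: numeral_eq_Suc mult_ac nz)

lemma petersen_sym: "petersen h z x y \<Longrightarrow> petersen h z y x"
proof (induction rule: petersen.induct)
  case (spoke a i)
  then show ?case using petersen.spoke[of a h z "\<not> i"] by simp
qed (rule petersen.intros; assumption)+

text \<open>The vertex opposite to the middle of the rim path cuts the octagon into two walks of
  length 4 without backtracking that leave \<open>(True, a)\<close> in opposite rim directions; they
  would have a common end. The other orientation follows by reversal.\<close>

lemma octagon_outer: "\<not> octagon (petersen h z) (True, b) (True, a) (True, c)"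
proof
  assume oct: "octagon (petersen h z) (True, b) (True, a) (True, c)"
  then obtain v where *: "petersen h z (True, b) (True, a)" "petersen h z (True, a) (True, c)" "b \<noteq> c"
    by (auto simp: octagon_def)
  hence a: "a \<noteq> 0" by (simp add: petersen_iff)
  have no: False if "octagon (petersen h z) (True, a / h) (True, a) (True, h * a)"
  proof -
    from that obtain v3 v4 v5 v6 v7 where v:
      "petersen h z (True, h * a) v3" "petersen h z v3 v4" "petersen h z v4 v5" "petersen h z v5 v6"
      "petersen h z v6 v7" "petersen h z v7 (True, a / h)"
      "(True, a) \<noteq> v3" "(True, h * a) \<noteq> v4" "v3 \<noteq> v5" "v4 \<noteq> v6" "v5 \<noteq> v7" "v6 \<noteq> (True, a / h)"
      "v7 \<noteq> (True, a)"
      unfolding octagon_def by blast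
    have "v5 \<in> forward_ends a" by (rule forward_ends[of a v3 v4 v5]) (use v a in auto)
    moreover have "v5 \<in> backward_ends a" by (rule backward_ends[of a v7 v6 v5]) (use v a petersen_sym in auto)
    ultimately show False using ends_disjoint[OF a] by auto
  qed
  from * petersen_sym[OF *(1)] nz a
  have "b = a / h \<and> c = h * a \<or> b = h * a \<and> c = a / h"
    by (auto simp: petersen_iff)
  moreover have "octagon (petersen h z) (True, c) (True, a) (True, b)"
    by (rule octagon_rev[OF oct petersen_sym])
  ultimately show False using no oct by metis
qed

text \<open>The octagon is a commutator: steps along \<open>h\<close>, \<open>z\<close>, back along
  \<open>h\<close>, back along \<open>z\<close>, separated by spokes, close up because
  multiplication commutes.\<close>

lemma octagon_spoke:
  assumes "petersen h z (i, a) (j, b)" "i = j"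
  shows "octagon (petersen h z) (i, a) (j, b) (\<not> j, b)"
proof -
  have *: "octagon (petersen h z) (True, a) (True, b) (False, b)"
    if "petersen h z (True, a) (True, b)" for a b
  proof -
    have "a \<noteq> 0" "b = h * a \<or> b = a / h" using that by (auto simp: petersen_iff)
    then show ?thesis using nz
      by (intro octagonI[of _ _ _ _ "(False, b * z)" "(True, b * z)" "(True, a * z)"
            "(False, a * z)" "(False, a)"]) (auto simp: petersen_iff)
  qed
  have **: "octagon (petersen h z) (False, a) (False, b) (True, b)"
    if "petersen h z (False, a) (False, b)" for a b
  proof -
    have "a \<noteq> 0" "b = z * a \<or> b = a / z" using that by (auto simp: petersen_iff)
    then show ?thesis using nz
      by (intro octagonI[of _ _ _ _ "(True, b * h)" "(False, b * h)" "(False, a * h)"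
            "(True, a * h)" "(True, a)"]) (auto simp: petersen_iff)
  qed
  show ?thesis using assms * ** by (cases i) auto
qed

end

text \<open>It reduces paths on the inner rim to paths on the outer rim of the graph with exchanged
  parameters.\<close>

lemma petersen_swap: "petersen h z (i, a) (j, b) \<Longrightarrow> petersen z h (\<not> i, a) (\<not> j, b)"
proof -
  assume "petersen h z (i, a) (j, b)"
  then show ?thesis
  proof cases
    case spoke
    then show ?thesis using petersen.spoke[of a z h "\<not> i"] by simp
  qed (simp_all add: petersen.out petersen.out' petersen.inn petersen.inn')
qed

lemma octagon_petersen:
  assumes "petersen_params h z" "petersen_params z h" "petersen h z (i, b) (j, a)"
    "petersen h z (j, a) (k, c)" "b \<noteq> c \<or> i \<noteq> k"
  shows "octagon (petersen h z) (i, b) (j, a) (k, c) \<longleftrightarrow> \<not> (i = j \<and> j = k)"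
proof (cases "i = j \<and> j = k")
  case True
  have "\<not> octagon (petersen h z) (False, b) (False, a) (False, c)"
  proof
    assume "octagon (petersen h z) (False, b) (False, a) (False, c)"
    from octagon_map[OF this, of "\<lambda>(i, a). (\<not> i, a)" "petersen z h" ]
    have "octagon (petersen z h) (True, b) (True, a) (True, c)"
      by (auto simp: inj_on_def petersen_swap)
    with petersen_params.octagon_outer[OF assms(2)] show False by blast
  qed
  with True petersen_params.octagon_outer[OF assms(1)] show ?thesis by (cases i) auto
next
  case False
  interpret petersen_params h z by fact
  have "i = j \<and> k = (\<not> j) \<and> c = a \<or> k = j \<and> i = (\<not> j) \<and> b = a"
    using False assms(3-5) by (auto simp: petersen_iff split: if_splits)
  then show ?thesis
  proof
    assume *: "i = j \<and> k = (\<not> j) \<and> c = a"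
    with octagon_spoke[OF assms(3)] False show ?thesis by simp
  next
    assume *: "k = j \<and> i = (\<not> j) \<and> b = a"
    hence "octagon (petersen h z) (k, c) (j, a) (i, b)"
      using octagon_spoke[OF petersen_sym[OF assms(4)]] by simp
    from octagon_rev[OF this petersen_sym] False show ?thesis by simp
  qed
qed

section \<open>Automorphisms\<close>

text \<open>\<open>h\<close> and \<open>z\<close> are \<open>\<eta>\<close> and \<open>\<zeta>\<close>.\<close>

locale frobenius_u = frobenius_graph s u for s :: "'a::{field,finite} \<Rightarrow> 'a" and u +
  fixes h :: 'a
  assumes h_nz: "h \<noteq> 0"
    and h_prim: "x \<noteq> 0 \<Longrightarrow> \<exists>n::nat. h ^ n = x"
    and u_eq: "u = (1 + s h) / (h + s h)"
    and h_63: "h ^ 63 \<noteq> 1" and h_15: "h ^ 15 \<noteq> 1"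
    and cube_inj: "x ^ 3 = y ^ 3 \<Longrightarrow> x = (y::'a)"
    and no_root: "s x * x + u * s x + (u + 1) * x + 1 \<noteq> 0"
    and card_nonsquare: "CARD('a) \<noteq> m ^ 2"
begin

section \<open>The subgraph induced on the neighbours of 1\<close>

definition z :: 'a where "z = (1 + h) / h"

lemma h_ne_1: "h \<noteq> 1" using h_15 by auto
lemma one_plus_h_nz: "1 + h \<noteq> 0" using h_ne_1 by auto
lemma h_plus_s_h_nz: "h + s h \<noteq> 0" using s_fixed[of h] h_ne_1 h_nz by auto

lemma h_plus_s_h_u: "(h + s h) * u = 1 + s h" using u_eq h_plus_s_h_nz by simp

text \<open>Every adjacency equation below is linear in \<open>u\<close>; this eliminates
  \<open>u\<close> together with its denominator.\<close>

lemma u_linear_eq_0: "u * x + y = 0 \<longleftrightarrow> (1 + s h) * x + (h + s h) * y = 0"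
proof -
  have "(h + s h) * (u * x + y) = (1 + s h) * x + (h + s h) * y"
    by (simp only: distrib_left h_plus_s_h_u flip: mult.assoc)
  then show ?thesis using h_plus_s_h_nz by (metis mult_eq_0_iff)
qed

text \<open>The equation says that \<open>x / y\<close> is fixed by \<open>s\<close>, and 1 is the
  only nonzero fixed point.\<close>

lemma s_ratio: "x \<noteq> 0 \<Longrightarrow> y \<noteq> 0 \<Longrightarrow> s x * y = x * s y \<longleftrightarrow> x = y"
proof
  assume "x \<noteq> 0" "y \<noteq> 0" "s x * y = x * s y"
  hence "s (x / y) = x / y" by (simp add: s_div field_simps)
  from s_fixed[OF this] \<open>x \<noteq> 0\<close> \<open>y \<noteq> 0\<close> show "x = y" by auto
qed auto

definition ingen :: "'a \<Rightarrow> 'a \<times> 'a" where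
  "ingen a = (a / (1 + h), (u + 1) * (s (a / (1 + h)) * (a / (1 + h))))"

text \<open>Without \<open>u\<close> the equation has the form of \<open>s_ratio\<close> for
  \<open>(1 + h) * a\<close> and \<open>a + b\<close>; the guard \<open>a \<noteq> b\<close> makes
  the second of them nonzero.\<close>

lemma arc_outgen_outgen:
  assumes "a \<noteq> 0" "b \<noteq> 0"
  shows "arc (outgen a) (outgen b) \<longleftrightarrow> b = h * a"
proof -
  have "arc (outgen a) (outgen b) \<longleftrightarrow> a \<noteq> b \<and>
      u * (s a * a) + u * (s b * b) = u * ((s a + s b) * (a + b)) + (s a + s b) * a"
    by (simp add: outgen_def s_add)
  also have "(u * (s a * a) + u * (s b * b) = u * ((s a + s b) * (a + b)) + (s a + s b) * a) \<longleftrightarrow> u * (s a * b + s b * a) + (s a + s b) * a = 0"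
    unfolding eq_iff_add[of "u * (s a * a) + u * (s b * b)"] by (simp add: algebra_simps del: add_eq_0)
  also have "\<dots> \<longleftrightarrow> (1 + s h) * s a * (a + b) + ((1 + h) * a) * (s a + s b) = 0"
    unfolding u_linear_eq_0 by (simp add: algebra_simps del: add_eq_0)
  also have "\<dots> \<longleftrightarrow> (1 + s h) * s a * (a + b) = ((1 + h) * a) * (s a + s b)"
    by (simp only: add_eq_0)
  also have "\<dots> \<longleftrightarrow> s ((1 + h) * a) * (a + b) = ((1 + h) * a) * s (a + b)"
    by (simp add: s_add s_mult)
  finally have "arc (outgen a) (outgen b) \<longleftrightarrow> a \<noteq> b \<and> (1 + h) * a = a + b"
    using s_ratio[of "(1 + h) * a" "a + b"] assms one_plus_h_nz by auto
  then show ?thesis using h_ne_1 assms by (auto simp: distrib_right)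
qed

text \<open>In unscaled labels \<open>s_ratio\<close> yields \<open>(1 + h) * (c + d) = d\<close>;
  solving for \<open>d\<close> produces the factor \<open>z\<close>.\<close>

lemma arc_ingen_ingen:
  assumes "a \<noteq> 0" "b \<noteq> 0"
  shows "arc (ingen a) (ingen b) \<longleftrightarrow> b = z * a"
proof -
  define c d where "c = a / (1 + h)" and "d = b / (1 + h)"
  have nz: "c \<noteq> 0" "d \<noteq> 0" using assms one_plus_h_nz by (auto simp: c_def d_def)
  have "arc (ingen a) (ingen b) \<longleftrightarrow> c \<noteq> d \<and>
      (u + 1) * (s c * c) + (u + 1) * (s d * d) = u * ((s c + s d) * (c + d)) + (s c + s d) * c"
    by (simp add: ingen_def s_add c_def d_def)
  also have "((u + 1) * (s c * c) + (u + 1) * (s d * d) = u * ((s c + s d) * (c + d)) + (s c + s d) * c) \<longleftrightarrow> u * (s c * d + s d * c) + (s d * d + s d * c) = 0"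
    unfolding eq_iff_add[of "(u + 1) * (s c * c) + (u + 1) * (s d * d)"] by (simp add: algebra_simps del: add_eq_0)
  also have "\<dots> \<longleftrightarrow> ((1 + s h) * (s c + s d)) * d + ((1 + h) * (c + d)) * s d = 0"
    unfolding u_linear_eq_0 by (simp add: algebra_simps del: add_eq_0)
  also have "\<dots> \<longleftrightarrow> ((1 + s h) * (s c + s d)) * d = ((1 + h) * (c + d)) * s d"
    by (simp only: add_eq_0)
  also have "\<dots> \<longleftrightarrow> s ((1 + h) * (c + d)) * d = ((1 + h) * (c + d)) * s d"
    by (simp add: s_add s_mult)
  finally have "arc (ingen a) (ingen b) \<longleftrightarrow> c \<noteq> d \<and> (1 + h) * (c + d) = d"
    using s_ratio[of "(1 + h) * (c + d)" d] nz one_plus_h_nz by auto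
  also have "\<dots> \<longleftrightarrow> h * d = (1 + h) * c"
  proof -
    have "(1 + h) * (c + d) + d = h * d + (1 + h) * c" by (simp add: algebra_simps)
    hence "(1 + h) * (c + d) = d \<longleftrightarrow> h * d = (1 + h) * c" by (metis add_eq_0)
    moreover have "c \<noteq> d" if "h * d = (1 + h) * c" using that nz by (auto simp: distrib_right)
    ultimately show ?thesis by blast
  qed
  also have "\<dots> \<longleftrightarrow> b = z * a" using h_nz one_plus_h_nz by (auto simp: c_def d_def z_def field_simps)
  finally show ?thesis .
qed

text \<open>Here \<open>s_ratio\<close> compares \<open>(1 + h) * c\<close> with \<open>b\<close>,
  where \<open>c\<close> is the unscaled label. This is the reason for the factor
  \<open>1 + h\<close> in \<open>ingen\<close>.\<close>

lemma arc_ingen_outgen: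
  assumes "a \<noteq> 0" "b \<noteq> 0"
  shows "arc (ingen a) (outgen b) \<longleftrightarrow> a = b"
proof -
  define c where "c = a / (1 + h)"
  have nz: "c \<noteq> 0" and a: "a = (1 + h) * c" using assms one_plus_h_nz by (auto simp: c_def)
  have "arc (ingen a) (outgen b) \<longleftrightarrow> c \<noteq> b \<and>
      (u + 1) * (s c * c) + u * (s b * b) = u * ((s c + s b) * (c + b)) + (s c + s b) * c"
    by (simp add: ingen_def outgen_def s_add c_def)
  also have "((u + 1) * (s c * c) + u * (s b * b) = u * ((s c + s b) * (c + b)) + (s c + s b) * c) \<longleftrightarrow> u * (s c * b + s b * c) + s b * c = 0"
    unfolding eq_iff_add[of "(u + 1) * (s c * c) + u * (s b * b)"] by (simp add: algebra_simps del: add_eq_0)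
  also have "\<dots> \<longleftrightarrow> ((1 + s h) * s c) * b + ((1 + h) * c) * s b = 0"
    unfolding u_linear_eq_0 by (simp add: algebra_simps del: add_eq_0)
  also have "\<dots> \<longleftrightarrow> ((1 + s h) * s c) * b = ((1 + h) * c) * s b"
    by (simp only: add_eq_0)
  also have "\<dots> \<longleftrightarrow> s a * b = a * s b"
    by (simp add: s_add s_mult a)
  finally have "arc (ingen a) (outgen b) \<longleftrightarrow> c \<noteq> b \<and> a = b"
    using s_ratio assms by auto
  also have "\<dots> \<longleftrightarrow> a = b" using a nz h_nz by (auto simp: distrib_right)
  finally show ?thesis .
qed

lemma arc_outgen_ingen:
  assumes "a \<noteq> 0" "b \<noteq> 0"
  shows "\<not> arc (outgen a) (ingen b)"
proof
  assume arc: "arc (outgen a) (ingen b)"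
  define c where "c = b / (1 + h)"
  have nz: "c \<noteq> 0" using assms one_plus_h_nz by (auto simp: c_def)
  \<comment> \<open>In terms of this ratio the adjacency equation is \<open>s c * c\<close> times
    the polynomial of (U2) at \<open>x\<close>.\<close>
  define x where "x = a / c"
  have a: "a = x * c" using nz by (simp add: x_def)
  from arc have "u * (s a * a) + (u + 1) * (s c * c) = u * ((s a + s c) * (a + c)) + (s a + s c) * a"
    by (simp add: ingen_def outgen_def s_add c_def)
  hence "u * (s a * a) + (u + 1) * (s c * c) + (u * ((s a + s c) * (a + c)) + (s a + s c) * a) = 0"
    by (simp only: add_eq_0)
  also have "u * (s a * a) + (u + 1) * (s c * c) + (u * ((s a + s c) * (a + c)) + (s a + s c) * a) =
      (s c * c) * (s x * x + u * s x + (u + 1) * x + 1)"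
    unfolding a s_mult by (simp add: algebra_simps)
  finally have "(s c * c) * (s x * x + u * s x + (u + 1) * x + 1) = 0" .
  with no_root[of x] nz show False by simp
qed

lemma arc_one_left: "arc (0, 0) x \<longleftrightarrow> (\<exists>a. a \<noteq> 0 \<and> x = outgen a)"
  by (simp add: arc_iff)

lemma arc_one_right: "arc x (0, 0) \<longleftrightarrow> (\<exists>a. a \<noteq> 0 \<and> x = ingen a)"
proof -
  have "arc x (0, 0) \<longleftrightarrow> fst x \<noteq> 0 \<and> snd x = (u + 1) * (s (fst x) * fst x)"
    by (cases x) (auto simp: algebra_simps)
  also have "\<dots> \<longleftrightarrow> (\<exists>a. a \<noteq> 0 \<and> x = ingen a)"
  proof
    assume "fst x \<noteq> 0 \<and> snd x = (u + 1) * (s (fst x) * fst x)"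
    then show "\<exists>a. a \<noteq> 0 \<and> x = ingen a" using one_plus_h_nz
      by (intro exI[of _ "fst x * (1 + h)"]) (auto simp: ingen_def prod_eq_iff)
  qed (use one_plus_h_nz in \<open>auto simp: ingen_def\<close>)
  finally show ?thesis .
qed

definition link_vertex :: "bool \<times> 'a \<Rightarrow> 'a \<times> 'a" where
  "link_vertex p = (if fst p then outgen (snd p) else ingen (snd p))"

lemma outgen_eq [simp]: "outgen a = outgen b \<longleftrightarrow> a = b"
  by (auto simp: outgen_def)

lemma ingen_eq [simp]: "ingen a = ingen b \<longleftrightarrow> a = b"
  using one_plus_h_nz by (auto simp: ingen_def)

lemma outgen_ne_ingen: "a \<noteq> 0 \<Longrightarrow> outgen a \<noteq> ingen b"
  by (auto simp: outgen_def ingen_def algebra_simps)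

lemma edge_one: "edge (0, 0) x \<longleftrightarrow> (\<exists>p. snd p \<noteq> 0 \<and> x = link_vertex p)"
  by (auto simp: edge_def arc_one_left arc_one_right link_vertex_def split: if_splits)

section \<open>Multiplicative relations between \<open>h\<close> and \<open>z\<close>\<close>

lemma sq_add: "(x + y)\<^sup>2 = x\<^sup>2 + (y\<^sup>2 :: 'a)"
  by (simp add: power2_eq_square algebra_simps)

lemma sq_inj: "x\<^sup>2 = y\<^sup>2 \<Longrightarrow> x = (y :: 'a)"
  by (metis sq_add add_eq_0 power2_eq_iff neg_char2(1))

lemma pow_64: "h ^ 64 \<noteq> h"
proof
  assume "h ^ 64 = h"
  moreover have "h ^ 64 = h * h ^ 63" by (simp flip: power_Suc)
  ultimately show False using h_63 h_nz by simp
qed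

text \<open>Each equation excluded here would force \<open>h\<^sup>6\<^sup>3 = 1\<close> or \<open>h\<^sup>1\<^sup>5 = 1\<close>.\<close>

lemma h_not_root:
  "h ^ 2 \<noteq> 1 + h" "h ^ 3 \<noteq> 1 + h" "h ^ 3 \<noteq> 1 + h ^ 2" "h ^ 4 \<noteq> 1 + h" "h ^ 5 \<noteq> 1"
  "h ^ 6 \<noteq> 1 + h" "h ^ 5 \<noteq> 1 + h ^ 4" "h ^ 5 \<noteq> 1 + h" "h ^ 6 \<noteq> 1 + h + h ^ 4 + h ^ 5"
proof -
  \<comment> \<open>Apart from \<open>h ^ 5 = 1\<close>, each assumed equation is refuted by
    repeated squaring, which acts term by term, with reduction modulo the equation, until
    \<open>h\<close> returns as \<open>h ^ 16\<close> or \<open>h ^ 64\<close>.\<close>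
  have pow: "h ^ 16 = (h ^ 8)\<^sup>2" "h ^ 32 = (h ^ 16)\<^sup>2" "h ^ 64 = (h ^ 32)\<^sup>2" "h ^ 8 = (h ^ 4)\<^sup>2"
    "(h ^ 2)\<^sup>2 = h ^ 4" "(h ^ 3)\<^sup>2 = h ^ 6" "(h ^ 4)\<^sup>2 = h ^ 8" "(h ^ 5)\<^sup>2 = h ^ 10"
    by (simp_all flip: power_mult)
  have step: "h ^ 4 = h * h ^ 3" "h ^ 5 = h * h ^ 4" "h ^ 6 = h * h ^ 5" "h ^ 7 = h * h ^ 6"
     "h ^ 8 = h * h ^ 7" "h ^ 3 = h * h ^ 2" "h ^ 15 = h ^ 7 * h ^ 8" "h ^ 10 = h\<^sup>2 * h ^ 8"
    by (simp_all flip: power_Suc power_add)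
  have mon: "h * h = h ^ 2" "h * h ^ 2 = h ^ 3" "h * h ^ 3 = h ^ 4" "h * h ^ 4 = h ^ 5"
    "h * h ^ 5 = h ^ 6" "h ^ 2 * h = h ^ 3" "h\<^sup>2 * h ^ 3 = h ^ 5" "h\<^sup>2 * h ^ 5 = h ^ 7"
    by (simp_all flip: power_Suc power_add power2_eq_square power_Suc2)
  show "h ^ 5 \<noteq> 1"
  proof
    assume "h ^ 5 = 1" hence "(h ^ 5) ^ 3 = 1" by simp
    then show False using h_15 by (simp flip: power_mult)
  qed
  have 15: "h ^ 15 = 1" if "h ^ 16 = h"
  proof -
    have "h ^ 16 = h * h ^ 15" by (simp flip: power_Suc)
    with that h_nz show ?thesis by simp
  qed
  show "h ^ 4 \<noteq> 1 + h"
  proof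
    assume 4: "h ^ 4 = 1 + h"
    have 8: "h ^ 8 = 1 + h ^ 2" unfolding pow(4) 4 sq_add by simp
    have 16: "h ^ 16 = h" unfolding pow(1) 8 sq_add pow(5) 4 by simp
    from 15[OF this] h_15 show False by simp
  qed
  show "h ^ 2 \<noteq> 1 + h"
  proof
    assume 2: "h ^ 2 = 1 + h"
    have 4: "h ^ 4 = h" unfolding pow(5)[symmetric] 2 sq_add by (simp add: 2)
    have 8: "h ^ 8 = h ^ 2" unfolding pow(4) 4 by simp
    have 16: "h ^ 16 = h" unfolding pow(1) 8 pow(5) 4 by simp
    from 15[OF this] h_15 show False by simp
  qed
  show "h ^ 3 \<noteq> 1 + h"
  proof
    assume 3: "h ^ 3 = 1 + h"
    have 4: "h ^ 4 = h + h\<^sup>2" unfolding step(1) 3 by (simp add: algebra_simps mon)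
    have 8: "h ^ 8 = h" unfolding pow(4) 4 sq_add pow(5) 4 by (simp add: algebra_simps)
    have "h ^ 64 = h" unfolding pow(1-3) 8 pow(5) 4 sq_add by (simp add: algebra_simps 4)
    with pow_64 show False by simp
  qed
  show "h ^ 3 \<noteq> 1 + h ^ 2"
  proof
    assume 3: "h ^ 3 = 1 + h ^ 2"
    have 4: "h ^ 4 = 1 + h + h\<^sup>2" unfolding step(1) 3 by (simp add: algebra_simps mon 3)
    have 8: "h ^ 8 = h" unfolding pow(4) 4 sq_add pow(5) 4 by (simp add: algebra_simps)
    have "h ^ 64 = h" unfolding pow(1-3) 8 pow(5) 4 sq_add by (simp add: 4 algebra_simps)
    with pow_64 show False by simp
  qed
  show "h ^ 6 \<noteq> 1 + h"
  proof
    assume 6: "h ^ 6 = 1 + h"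
    have 8: "h ^ 8 = h\<^sup>2 + h ^ 3" unfolding step(5) step(4) 6 by (simp add: algebra_simps mon)
    have 16: "h ^ 16 = 1 + h + h ^ 4" unfolding pow(1) 8 sq_add pow 6 by (simp add: algebra_simps)
    have 32: "h ^ 32 = 1 + h ^ 3" unfolding pow(2) 16 sq_add pow(7) 8 by (simp add: algebra_simps)
    have "h ^ 64 = h" unfolding pow(3) 32 sq_add pow(6) 6 by simp
    with pow_64 show False by simp
  qed
  show "h ^ 5 \<noteq> 1 + h ^ 4"
  proof
    assume 5: "h ^ 5 = 1 + h ^ 4"
    have 6: "h ^ 6 = 1 + h + h ^ 4" unfolding step(3) 5 by (simp add: algebra_simps mon 5)
    have 7: "h ^ 7 = 1 + h + h\<^sup>2 + h ^ 4" unfolding step(4) 6 by (simp add: algebra_simps mon 5)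
    have 8: "h ^ 8 = 1 + h + h\<^sup>2 + h ^ 3 + h ^ 4" unfolding step(5) 7 by (simp add: algebra_simps mon 5)
    have 16: "h ^ 16 = 1 + h ^ 3 + h ^ 4"
      unfolding pow(1) 8 sq_add pow(5,6,7) 6 unfolding 8 by (simp add: algebra_simps)
    have 32: "h ^ 32 = 1 + h\<^sup>2 + h ^ 3"
      unfolding pow(2) 16 sq_add pow(5,6,7) 6 8 by (simp add: algebra_simps)
    have "h ^ 64 = h" unfolding pow(3) 32 sq_add pow(5,6) 6 by (simp add: algebra_simps)
    with pow_64 show False by simp
  qed
  show "h ^ 5 \<noteq> 1 + h"
  proof
    assume 5: "h ^ 5 = 1 + h"
    have 6: "h ^ 6 = h + h\<^sup>2" unfolding step(3) 5 by (simp add: algebra_simps mon 5)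
    have 8: "h ^ 8 = h ^ 3 + h ^ 4" unfolding step(5) step(4) 6 by (simp add: algebra_simps mon 5)
    have 16: "h ^ 16 = h + h\<^sup>2 + h ^ 3 + h ^ 4"
      unfolding pow(1) 8 sq_add pow(5,6,7) 6 unfolding 8 by (simp add: algebra_simps)
    have 32: "h ^ 32 = h + h ^ 3"
      unfolding pow(2) 16 sq_add pow(5,6,7) 6 8 by (simp add: algebra_simps)
    have "h ^ 64 = h" unfolding pow(3) 32 sq_add pow(5,6) 6 by (simp add: algebra_simps)
    with pow_64 show False by simp
  qed
  show "h ^ 6 \<noteq> 1 + h + h ^ 4 + h ^ 5"
  proof
    assume 6: "h ^ 6 = 1 + h + h ^ 4 + h ^ 5"
    have 7: "h ^ 7 = 1 + h\<^sup>2 + h ^ 4" unfolding step(4) 6 by (simp add: algebra_simps mon 6)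
    have 8: "h ^ 8 = h + h ^ 3 + h ^ 5" unfolding step(5) 7 by (simp add: algebra_simps mon)
    have 10: "h ^ 10 = 1 + h\<^sup>2 + h ^ 3 + h ^ 4 + h ^ 5"
      unfolding step(8) 8 by (simp add: algebra_simps mon 7)
    have 16: "h ^ 16 = h + h ^ 3"
      unfolding pow(1) 8 sq_add pow(5-8) 6 10 by (simp add: algebra_simps)
    have 32: "h ^ 32 = 1 + h + h\<^sup>2 + h ^ 4 + h ^ 5"
      unfolding pow(2) 16 sq_add pow(5-8) 6 by (simp add: algebra_simps)
    have "h ^ 64 = h" unfolding pow(3) 32 sq_add pow(5-8) 8 10 by (simp add: algebra_simps)
    with pow_64 show False by simp
  qed
qed

lemma z_nz: "z \<noteq> 0" using h_nz one_plus_h_nz by (simp add: z_def)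

text \<open>Since \<open>h * z = 1 + h\<close>, multiplying by a suitable power of \<open>h\<close>
  removes \<open>z\<close> and leaves a polynomial equation for \<open>h\<close> that
  \<open>h_not_root\<close> excludes.\<close>

lemma no_relation:
  "h \<noteq> z" "h * z \<noteq> 1" "z \<noteq> 1"
  "h ^ 2 \<noteq> z" "h ^ 2 * z \<noteq> 1" "h ^ 3 \<noteq> z" "h ^ 3 * z \<noteq> 1" "h ^ 5 \<noteq> z" "h ^ 5 * z \<noteq> 1"
  "z ^ 2 \<noteq> h" "z ^ 2 * h \<noteq> 1" "z ^ 3 \<noteq> h" "z ^ 3 * h \<noteq> 1" "z ^ 5 \<noteq> h" "z ^ 5 * h \<noteq> 1"
proof -
  have hz: "h * z = 1 + h" using h_nz by (simp add: z_def)
  have mon: "h * h ^ 2 = h ^ 3" "h * h ^ 3 = h ^ 4" "h * h ^ 5 = h ^ 6"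
    by (simp_all flip: power_Suc)
  have t2: "(1 + h)\<^sup>2 = 1 + h\<^sup>2" by (simp add: sq_add)
  have t3: "(1 + h) ^ 3 = 1 + h + h ^ 2 + h ^ 3"
    by (simp add: power2_eq_square power3_eq_cube algebra_simps)
  have t5: "(1 + h) ^ 5 = 1 + h + h ^ 4 + h ^ 5"
    by (simp add: numeral_eq_Suc algebra_simps)
  have hz2: "h ^ 2 * z ^ 2 = 1 + h ^ 2" and hz3: "h ^ 3 * z ^ 3 = 1 + h + h ^ 2 + h ^ 3"
    and hz5: "h ^ 5 * z ^ 5 = 1 + h + h ^ 4 + h ^ 5"
    by (simp_all add: hz t2 t3 t5 flip: power_mult_distrib)
  show "h * z \<noteq> 1" using hz h_nz by simp
  show "z \<noteq> 1" using hz by auto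
  show "h \<noteq> z" using hz h_not_root(1) by (metis power2_eq_square)
  show "h ^ 2 \<noteq> z" using hz h_not_root(2) mon(1) by metis
  show "h ^ 3 \<noteq> z" using hz h_not_root(4) mon(2) by metis
  show "h ^ 5 \<noteq> z" using hz h_not_root(6) mon(3) by metis
  show "h ^ 2 * z \<noteq> 1"
  proof
    assume "h ^ 2 * z = 1"
    hence "h * (h * z) = 1" by (simp add: power2_eq_square mult.assoc)
    hence "h ^ 2 + (1 + h) = 0" unfolding hz by (simp add: algebra_simps power2_eq_square)
    with h_not_root(1) show False by simp
  qed
  show "h ^ 3 * z \<noteq> 1"
  proof
    assume "h ^ 3 * z = 1"
    hence "h ^ 2 * (h * z) = 1" by (simp add: power2_eq_square power3_eq_cube mult.assoc)
    hence "h ^ 3 + (1 + h ^ 2) = 0"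
      unfolding hz by (simp add: algebra_simps power2_eq_square power3_eq_cube)
    with h_not_root(3) show False by simp
  qed
  show "h ^ 5 * z \<noteq> 1"
  proof
    assume "h ^ 5 * z = 1"
    hence "h ^ 4 * (h * z) = 1" by (simp add: numeral_eq_Suc mult.assoc)
    hence "h ^ 4 + h ^ 5 = 1" unfolding hz by (simp add: algebra_simps flip: power_Suc)
    hence "h ^ 5 = 1 + h ^ 4" by (metis add.commute dbl(2))
    with h_not_root(7) show False by simp
  qed
  show "z ^ 2 \<noteq> h"
  proof
    assume "z ^ 2 = h"
    hence "h ^ 2 * h = 1 + h ^ 2" using hz2 by simp
    with h_not_root(3) show False by (simp add: power2_eq_square power3_eq_cube)
  qed
  show "z ^ 2 * h \<noteq> 1"
  proof
    assume "z ^ 2 * h = 1"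
    hence "(h ^ 2 * z ^ 2) * h = h * h" by (simp add: mult.assoc power2_eq_square)
    hence "(1 + h ^ 2) * h = h * h" by (simp only: hz2)
    hence "1 + h ^ 2 = h" using h_nz mult_right_cancel by blast
    hence "h ^ 2 = 1 + h" by (metis dbl(2))
    with h_not_root(1) show False by simp
  qed
  show "z ^ 3 \<noteq> h"
  proof
    assume "z ^ 3 = h"
    \<comment> \<open>This is the vanishing of the geometric sum 1 + h + ... + h^4, so it leads to
      \<open>h ^ 5 = 1\<close>.\<close>
    hence 4: "h ^ 4 = 1 + h + h ^ 2 + h ^ 3" using hz3 mon(2) by (simp add: mult.commute)
    have "h ^ 5 = h * h ^ 4" by (simp flip: power_Suc)
    also have "\<dots> = h + h ^ 2 + h ^ 3 + h ^ 4"
      unfolding 4 distrib_left mon by (simp add: power2_eq_square)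
    also have "\<dots> = 1" unfolding 4 by (simp add: algebra_simps)
    finally have "h ^ 5 = 1" .
    with h_not_root(5) show False by simp
  qed
  show "z ^ 3 * h \<noteq> 1"
  proof
    assume *: "z ^ 3 * h = 1"
    have "h * (1 + h + h ^ 2 + h ^ 3) = h ^ 3 * (z ^ 3 * h)" unfolding hz3[symmetric] by (simp only: mult_ac)
    also have "\<dots> = h * h ^ 2" unfolding * by (simp add: power2_eq_square power3_eq_cube)
    finally have "1 + h + h ^ 2 + h ^ 3 = h ^ 2" using h_nz by simp
    moreover have "h ^ 3 + (1 + h) = (1 + h + h ^ 2 + h ^ 3) + h ^ 2"
      by (simp add: algebra_simps numeral_two)
    ultimately have "h ^ 3 + (1 + h) = 0" by (simp only: dbl(1))
    with h_not_root(2) show False by simp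
  qed
  show "z ^ 5 \<noteq> h"
  proof
    assume "z ^ 5 = h"
    hence "h ^ 6 = 1 + h + h ^ 4 + h ^ 5" using hz5 by (simp add: mult.commute flip: power_Suc)
    with h_not_root(9) show False by simp
  qed
  show "z ^ 5 * h \<noteq> 1"
  proof
    assume *: "z ^ 5 * h = 1"
    have "h * (1 + h + h ^ 4 + h ^ 5) = h ^ 5 * (z ^ 5 * h)" unfolding hz5[symmetric] by (simp only: mult_ac)
    also have "\<dots> = h * h ^ 4" unfolding * by (simp flip: power_Suc)
    finally have "1 + h + h ^ 4 + h ^ 5 = h ^ 4" using h_nz by simp
    moreover have "h ^ 5 + (1 + h) = (1 + h + h ^ 4 + h ^ 5) + h ^ 4"
      by (simp add: algebra_simps numeral_two)
    ultimately have "h ^ 5 + (1 + h) = 0" by (simp only: dbl(1))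
    with h_not_root(8) show False by simp
  qed
qed

lemma petersen_params: "petersen_params h z" "petersen_params z h"
proof -
  have z_rel': "z * h \<noteq> 1" "z \<noteq> h" using no_relation by (simp_all add: mult.commute)
  show "petersen_params h z"
    by unfold_locales (use h_nz z_nz h_ne_1 no_relation in \<open>simp_all only: not_False_eq_True\<close>,
      (erule sq_inj | erule cube_inj)+)
  show "petersen_params z h"
    by unfold_locales (use h_nz z_nz h_ne_1 no_relation z_rel' in \<open>simp_all only: not_False_eq_True\<close>,
      (erule sq_inj | erule cube_inj)+)
qed

section \<open>Automorphisms fixing 1 and the two rims\<close>

definition link_edge :: "'a \<times> 'a \<Rightarrow> 'a \<times> 'a \<Rightarrow> bool" where
  "link_edge x y \<longleftrightarrow> edge (0, 0) x \<and> edge (0, 0) y \<and> edge x y"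

lemma link_vertex_inj: "inj_on link_vertex {p. snd p \<noteq> 0}"
  using outgen_ne_ingen by (auto simp: inj_on_def link_vertex_def split: if_splits) metis+

lemma link_edge_petersen:
  assumes "a \<noteq> 0" "b \<noteq> 0"
  shows "link_edge (link_vertex (i, a)) (link_vertex (j, b)) \<longleftrightarrow> petersen h z (i, a) (j, b)"
proof -
  interpret petersen_params h z by (rule petersen_params)
  have "edge (0, 0) (link_vertex (i, a))" "edge (0, 0) (link_vertex (j, b))"
    using assms edge_one by fastforce+
  hence "link_edge (link_vertex (i, a)) (link_vertex (j, b)) \<longleftrightarrow>
     arc (link_vertex (i, a)) (link_vertex (j, b)) \<or> arc (link_vertex (j, b)) (link_vertex (i, a))"
    by (simp add: link_edge_def edge_def)
  then show ?thesis using assms h_nz z_nz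
    by (cases i; cases j)
      (auto simp: link_vertex_def arc_outgen_outgen arc_ingen_ingen arc_ingen_outgen
         arc_outgen_ingen petersen_iff)
qed

lemma arc_link_vertex: "a \<noteq> 0 \<Longrightarrow> arc (0, 0) (link_vertex (i, a)) \<longleftrightarrow> i"
  using outgen_ne_ingen by (auto simp: arc_one_left link_vertex_def) metis

lemma link_edgeE:
  assumes "link_edge x y"
  obtains i a j b where "a \<noteq> 0" "b \<noteq> 0" "x = link_vertex (i, a)" "y = link_vertex (j, b)"
    "petersen h z (i, a) (j, b)"
proof -
  from assms obtain p q where "snd p \<noteq> 0" "snd q \<noteq> 0" "x = link_vertex p" "y = link_vertex q"
    by (auto simp: link_edge_def edge_one)
  with that[of "snd p" "snd q" "fst p" "fst q"] assms
    link_edge_petersen[of "snd p" "snd q" "fst p" "fst q"] show thesis by auto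
qed

text \<open>\<open>arc (0, 0) v\<close> tells on which rim a neighbour \<open>v\<close> of 1 lies.
  Octagons are transported in both directions along the labelling, which is inverted on nonzero
  labels only.\<close>

lemma octagon_link:
  assumes "link_edge x y" "link_edge y w" "x \<noteq> w"
  shows "octagon link_edge x y w \<longleftrightarrow> \<not> (arc (0, 0) x = arc (0, 0) y \<and> arc (0, 0) y = arc (0, 0) w)"
proof -
  obtain i a j b where xy: "a \<noteq> 0" "b \<noteq> 0" "x = link_vertex (i, a)" "y = link_vertex (j, b)"
    "petersen h z (i, a) (j, b)" using link_edgeE[OF assms(1)] .
  obtain j' b' k c where "b' \<noteq> 0" "c \<noteq> 0" "y = link_vertex (j', b')" "w = link_vertex (k, c)"
    "petersen h z (j', b') (k, c)" using link_edgeE[OF assms(2)] .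
  moreover from this xy have "(j', b') = (j, b)"
    using inj_onD[OF link_vertex_inj, of "(j, b)" "(j', b')"] by auto
  ultimately have w: "c \<noteq> 0" "w = link_vertex (k, c)" "petersen h z (j, b) (k, c)" by auto
  define V where "V = {p :: bool \<times> 'a. snd p \<noteq> 0}"
  let ?g = "inv_into V link_vertex"
  have inj: "inj_on link_vertex V" using link_vertex_inj by (simp add: V_def)
  have g: "?g (link_vertex (i, a)) = (i, a)" if "a \<noteq> 0" for i a
    using that by (intro inv_into_f_f[OF inj]) (simp add: V_def)
  have ne: "petersen h z (i, a) (j, b) \<Longrightarrow> a \<noteq> 0 \<and> b \<noteq> 0" for i a j b
    using h_nz z_nz by (auto elim: petersen.cases)
  have "octagon (petersen h z) (i, a) (j, b) (k, c)" if "octagon link_edge x y w"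
  proof -
    have "octagon (petersen h z) (?g x) (?g y) (?g w)"
    proof (rule octagon_map[OF that])
      show "inj_on ?g {x. \<exists>y. link_edge x y}"
      proof (rule inj_onI)
        fix x x' assume "x \<in> {x. \<exists>y. link_edge x y}" "x' \<in> {x. \<exists>y. link_edge x y}" "?g x = ?g x'"
        then show "x = x'" by (auto elim!: link_edgeE simp: g)
      qed
      show "petersen h z (?g x) (?g y)" if "link_edge x y" for x y
        using that by (auto elim!: link_edgeE simp: g)
    qed
    then show ?thesis using xy w by (simp add: g)
  qed
  moreover have "octagon link_edge x y w" if "octagon (petersen h z) (i, a) (j, b) (k, c)"
    unfolding xy w
  proof (rule octagon_map[OF that])
    show "inj_on link_vertex {x. \<exists>y. petersen h z x y}"
      using ne by (intro inj_on_subset[OF inj]) (auto simp: V_def)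
    show "link_edge (link_vertex x) (link_vertex y)" if "petersen h z x y" for x y
      using link_edge_petersen[of "snd x" "snd y" "fst x" "fst y"] that ne[of "fst x" "snd x" "fst y" "snd y"]
      by simp
  qed
  moreover have "octagon (petersen h z) (i, a) (j, b) (k, c) \<longleftrightarrow> \<not> (i = j \<and> j = k)"
    by (rule octagon_petersen[OF petersen_params xy(5) w(3)]) (use assms(3) xy(3) w(2) in \<open>cases "i = k"; auto\<close>)
  ultimately show ?thesis using xy w arc_link_vertex by auto
qed

definition aut :: "('a \<times> 'a \<Rightarrow> 'a \<times> 'a) \<Rightarrow> bool" where
  "aut g \<longleftrightarrow> bij g \<and> (\<forall>x y. edge (g x) (g y) \<longleftrightarrow> edge x y)"

lemma aut_inv: "aut g \<Longrightarrow> aut (inv g)"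
  unfolding aut_def by (metis bij_imp_bij_inv bij_inv_eq_iff)

lemma aut_comp: "aut g \<Longrightarrow> aut g' \<Longrightarrow> aut (\<lambda>x. g (g' x))"
  unfolding aut_def using bij_comp[of g' g] by (auto simp: o_def simp del: split_paired_All)

lemma link_edge_aut: "aut g \<Longrightarrow> g (0, 0) = (0, 0) \<Longrightarrow> link_edge (g x) (g y) \<longleftrightarrow> link_edge x y"
  unfolding link_edge_def aut_def by metis

text \<open>A rim edge extends to a rim path of length 2, which lies on no octagon. Neither does its
  image, so the image path stays within one rim.\<close>

lemma aut_rim:
  assumes g: "aut g" "g (0, 0) = (0, 0)" and xy: "link_edge x y" "arc (0, 0) x = arc (0, 0) y"
  shows "arc (0, 0) (g x) = arc (0, 0) (g y)"
proof -
  interpret petersen_params h z by (rule petersen_params)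
  have inj: "inj g" using g by (auto simp: aut_def bij_def)
  obtain i a j b where ab: "a \<noteq> 0" "b \<noteq> 0" "x = link_vertex (i, a)" "y = link_vertex (j, b)"
    "petersen h z (i, a) (j, b)" using link_edgeE[OF xy(1)] .
  hence "i = j" using xy(2) by (simp add: arc_link_vertex)
  define r where "r = (if i then h else z)"
  \<comment> \<open>\<open>c\<close> continues from \<open>a\<close> to \<open>b\<close> in the same
    direction along the rim; \<open>r\<^sup>2 \<noteq> 1\<close> ensures that it does not return to
    \<open>a\<close>.\<close>
  define c where "c = (if b = r * a then r * b else b / r)"
  have r: "r \<noteq> 0" "r\<^sup>2 \<noteq> 1" using h_nz z_nz sq_inj[of r 1] h_ne_1 no_relation(3) by (auto simp: r_def)
  have "b = r * a \<or> b = a / r" using ab \<open>i = j\<close> by (auto simp: petersen_iff r_def split: if_splits)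
  hence c: "c \<noteq> 0" "c \<noteq> a" using r ab
    by (auto simp: c_def power2_eq_square field_simps)
  have "petersen h z (j, b) (i, c)"
    using ab \<open>i = j\<close> by (auto simp: petersen_iff c_def r_def)
  hence w: "link_edge y (link_vertex (i, c))"
    using ab c by (simp add: link_edge_petersen)
  have ne: "x \<noteq> link_vertex (i, c)"
    using ab c inj_onD[OF link_vertex_inj, of "(i, a)" "(i, c)"] by auto
  have "\<not> octagon link_edge x y (link_vertex (i, c))"
    using octagon_link[OF xy(1) w ne] ab c \<open>i = j\<close> by (simp add: arc_link_vertex)
  moreover have "octagon link_edge x y (link_vertex (i, c))"
    if "octagon link_edge (g x) (g y) (g (link_vertex (i, c)))"
  proof -
    have "inv g (0, 0) = (0, 0)" using inv_f_eq[OF inj g(2)] .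
    note inv = link_edge_aut[OF aut_inv[OF g(1)] this]
    have "inj (inv g)" using aut_inv[OF g(1)] by (simp add: aut_def bij_def)
    hence "inj_on (inv g) {x. \<exists>y. link_edge x y}" by (rule inj_on_subset) simp
    with that have "octagon link_edge (inv g (g x)) (inv g (g y)) (inv g (g (link_vertex (i, c))))"
      by (rule octagon_map) (simp only: inv)
    then show ?thesis by (simp add: inv_f_f[OF inj])
  qed
  ultimately have "\<not> octagon link_edge (g x) (g y) (g (link_vertex (i, c)))" by blast
  moreover have "link_edge (g x) (g y)" "link_edge (g y) (g (link_vertex (i, c)))"
    using link_edge_aut[OF g] xy w by auto
  moreover have "g x \<noteq> g (link_vertex (i, c))" using ne inj by (auto dest: injD)
  ultimately show ?thesis using octagon_link by blast
qed

text \<open>Rim edges propagate the image rim through all powers of \<open>h\<close>, so the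
  out-neighbours of 1 go to one side as a whole. The two sides have equal size, hence they fill that
  side, and the in-neighbours are forced to the other one.\<close>

lemma aut_local:
  assumes g: "aut g" "g (0, 0) = (0, 0)"
  shows "(\<forall>x. (arc (0, 0) x \<longrightarrow> arc (0, 0) (g x)) \<and> (arc x (0, 0) \<longrightarrow> arc (g x) (0, 0))) \<or>
         (\<forall>x. (arc (0, 0) x \<longrightarrow> arc (g x) (0, 0)) \<and> (arc x (0, 0) \<longrightarrow> arc (0, 0) (g x)))"
proof -
  interpret petersen_params h z by (rule petersen_params)
  have inj: "inj g" using g by (auto simp: aut_def bij_def)
  have edge: "arc (0, 0) (g x) \<or> arc (g x) (0, 0)" if "arc (0, 0) x \<or> arc x (0, 0)" for x
    using g that unfolding aut_def edge_def by metis
  have pow: "arc (0, 0) (g (outgen (h ^ n))) = arc (0, 0) (g (outgen 1))" for n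
  proof (induction n)
    case (Suc n)
    have "link_edge (link_vertex (True, h ^ n)) (link_vertex (True, h * h ^ n))"
      using h_nz by (subst link_edge_petersen) (auto simp: petersen_iff)
    from aut_rim[OF g this] Suc show ?case using h_nz
      by (simp add: arc_link_vertex) (simp add: link_vertex_def)
  qed simp
  hence const: "arc (0, 0) (g (outgen a)) = arc (0, 0) (g (outgen 1))" if "a \<noteq> 0" for a
    using h_prim[OF that] by auto
  define Out In where "Out = {x. arc (0, 0) x}" and "In = {x. arc x (0, 0)}"
  have Out: "Out = outgen ` (UNIV - {0})" and In: "In = ingen ` (UNIV - {0})"
    by (auto simp: Out_def In_def arc_one_left arc_one_right)
  have disj: "Out \<inter> In = {}" using arc_asym by (auto simp: Out_def In_def)
  have card: "card Out = card In" unfolding Out In by (simp add: card_image inj_on_def)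
  have img: "g ` Out = S" if "g ` Out \<subseteq> S" "card S = card Out" for S :: "('a \<times> 'a) set"
    using that by (intro card_subset_eq) (auto simp: card_image inj_on_subset[OF inj])
  have rest: "g x \<notin> g ` Out" if "x \<in> In" for x
    using that disj inj by (auto dest: injD)
  have gI: "g x \<in> Out \<union> In" if "x \<in> In" for x using edge that by (auto simp: Out_def In_def)
  show ?thesis
  proof (cases "arc (0, 0) (g (outgen 1))")
    case True
    have "g x \<in> Out" if "x \<in> Out" for x
    proof -
      from that obtain a where "a \<noteq> 0" "x = outgen a" by (auto simp: Out)
      with const[of a] True show ?thesis by (simp add: Out_def)
    qed
    hence "g ` Out \<subseteq> Out" by blast
    with img[of Out] have "g ` Out = Out" by simp
    with rest gI have "g x \<in> In" if "x \<in> In" for x using that by blast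
    with \<open>g ` Out = Out\<close> show ?thesis unfolding Out_def In_def by blast
  next
    case False
    have "g x \<in> In" if "x \<in> Out" for x
    proof -
      from that obtain a where a: "a \<noteq> 0" "x = outgen a" by (auto simp: Out)
      with const[of a] False have "\<not> arc (0, 0) (g x)" by simp
      with that edge[of x] show ?thesis by (simp add: Out_def In_def)
    qed
    hence "g ` Out \<subseteq> In" by blast
    with img[of In] card have "g ` Out = In" by simp
    with rest gI have "g x \<in> Out" if "x \<in> In" for x using that by blast
    with \<open>g ` Out = In\<close> show ?thesis unfolding Out_def In_def by blast
  qed
qed

section \<open>Arc-preserving and arc-reversing automorphisms\<close>

definition arc_pres :: "('a \<times> 'a \<Rightarrow> 'a \<times> 'a) \<Rightarrow> bool" where
  "arc_pres g \<longleftrightarrow> (\<forall>x y. arc x y \<longrightarrow> arc (g x) (g y))"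

definition arc_rev :: "('a \<times> 'a \<Rightarrow> 'a \<times> 'a) \<Rightarrow> bool" where
  "arc_rev g \<longleftrightarrow> (\<forall>x y. arc x y \<longrightarrow> arc (g y) (g x))"

lemma aut_kmul: "aut (\<lambda>x. kmul x k)"
proof -
  have "bij (\<lambda>x. kmul x k)"
    by (rule o_bij[of "\<lambda>x. kmul x (kinv k)"]) (simp_all add: fun_eq_iff del: split_paired_All)
  then show ?thesis by (simp only: aut_def edge_kmul simp_thms)
qed

lemma aut_kconj:
  assumes "l \<noteq> 0"
  shows "aut (kconj l)"
proof -
  have "bij (kconj l)" using assms
    by (intro o_bij[of "kconj (1 / l)"]) (simp_all add: fun_eq_iff del: split_paired_All kconj.simps)
  then show ?thesis by (simp only: aut_def edge_kconj[OF assms] simp_thms)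
qed

lemma arc_pres_kmul: "arc_pres (\<lambda>x. kmul x k)"
  by (simp add: arc_pres_def del: split_paired_All)

lemma arc_pres_kconj: "l \<noteq> 0 \<Longrightarrow> arc_pres (kconj l)"
  by (simp add: arc_pres_def arc_kconj del: split_paired_All)

lemma arc_pres_comp: "arc_pres g \<Longrightarrow> arc_pres g' \<Longrightarrow> arc_pres (\<lambda>x. g (g' x))"
  unfolding arc_pres_def by blast

text \<open>Translations move the local alternative to every vertex. It cannot change along an edge,
  since the endpoints would disagree about the direction of the image of that edge.\<close>

lemma aut_pres_or_rev:
  assumes g: "aut g"
  shows "arc_pres g \<or> arc_rev g"
proof -
  define P where "P v \<longleftrightarrow> (\<forall>x. (arc v x \<longrightarrow> arc (g v) (g x)) \<and> (arc x v \<longrightarrow> arc (g x) (g v)))" for v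
  define R where "R v \<longleftrightarrow> (\<forall>x. (arc v x \<longrightarrow> arc (g x) (g v)) \<and> (arc x v \<longrightarrow> arc (g v) (g x)))" for v
  have PR: "P v \<or> R v" for v
  proof -
    let ?g = "\<lambda>x. kmul (g (kmul x v)) (kinv (g v))"
    have "aut ?g" using aut_comp[OF aut_kmul aut_comp[OF g aut_kmul]] .
    moreover have "?g (0, 0) = (0, 0)" by simp
    moreover have "arc (0, 0) x \<longleftrightarrow> arc v (kmul x v)" "arc x (0, 0) \<longleftrightarrow> arc (kmul x v) v" for x
      using arc_kmul[of "(0, 0)" v x] arc_kmul[of x v "(0, 0)"] by simp_all
    moreover have "arc (0, 0) (?g x) \<longleftrightarrow> arc (g v) (g (kmul x v))"
      "arc (?g x) (0, 0) \<longleftrightarrow> arc (g (kmul x v)) (g v)" for x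
      using arc_kmul[of "g v" "kinv (g v)" "g (kmul x v)"]
         arc_kmul[of "g (kmul x v)" "kinv (g v)" "g v"] by simp_all
    ultimately have "(\<forall>x. (arc v (kmul x v) \<longrightarrow> arc (g v) (g (kmul x v))) \<and>
        (arc (kmul x v) v \<longrightarrow> arc (g (kmul x v)) (g v))) \<or>
      (\<forall>x. (arc v (kmul x v) \<longrightarrow> arc (g (kmul x v)) (g v)) \<and>
        (arc (kmul x v) v \<longrightarrow> arc (g v) (g (kmul x v))))"
      using aut_local[of ?g] by (simp del: split_paired_All)
    moreover have "\<exists>y. x = kmul y v" for x by (metis kmul_kinv_cancel(4))
    ultimately show ?thesis unfolding P_def R_def by metis
  qed
  have P: "P x \<Longrightarrow> edge x y \<Longrightarrow> P y" for x y
    using PR[of y] arc_asym unfolding P_def R_def edge_def by metis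
  have P': "P x \<Longrightarrow> P y" for x y
    using edge_connected[of x y] by (induction rule: rtranclp_induct) (auto intro: P)
  show ?thesis
  proof (cases "P (0, 0)")
    case True
    with P' have "P x" for x by blast
    then show ?thesis unfolding P_def arc_pres_def by blast
  next
    case False
    with P' PR have "R x" for x by blast
    then show ?thesis unfolding R_def arc_rev_def by blast
  qed
qed

text \<open>The successor of a vertex on the outer rim is unique, so one fixed out-neighbour fixes
  that rim, a single cycle; the spokes then fix the in-neighbours.\<close>

lemma arc_pres_fix_one:
  assumes g: "aut g" "arc_pres g" "g (0, 0) = (0, 0)" "g (outgen b) = outgen b" "b \<noteq> 0"
    and x: "edge (0, 0) x"
  shows "g x = x"
proof -
  have pow: "g (outgen (h ^ n * b)) = outgen (h ^ n * b)" for n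
  proof (induction n)
    case (Suc n)
    let ?a = "h ^ n * b"
    have a: "?a \<noteq> 0" "h * ?a \<noteq> 0" using h_nz g by auto
    hence "arc (0, 0) (outgen (h * ?a))" by (auto simp: arc_one_left)
    with g have "arc (0, 0) (g (outgen (h * ?a)))" unfolding arc_pres_def by metis
    then obtain c where c: "c \<noteq> 0" "g (outgen (h * ?a)) = outgen c" by (auto simp: arc_one_left)
    have "arc (outgen ?a) (outgen (h * ?a))" using a by (simp add: arc_outgen_outgen)
    with g have "arc (g (outgen ?a)) (g (outgen (h * ?a)))" unfolding arc_pres_def by blast
    hence "c = h * ?a" using c a by (simp add: Suc arc_outgen_outgen)
    with c show ?case by (simp add: mult.assoc)
  qed (use g in simp)
  have out: "g (outgen a) = outgen a" if "a \<noteq> 0" for a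
  proof -
    from that g have "a / b \<noteq> 0" by simp
    from h_prim[OF this] obtain n where "h ^ n = a / b" ..
    with pow[of n] g show ?thesis by simp
  qed
  have inn: "g (ingen a) = ingen a" if a: "a \<noteq> 0" for a
  proof -
    have "arc (ingen a) (0, 0)" using a by (auto simp: arc_one_right)
    with g have "arc (g (ingen a)) (0, 0)" unfolding arc_pres_def by metis
    then obtain c where c: "c \<noteq> 0" "g (ingen a) = ingen c" by (auto simp: arc_one_right)
    have "arc (ingen a) (outgen a)" using a by (simp add: arc_ingen_outgen)
    with g have "arc (g (ingen a)) (g (outgen a))" unfolding arc_pres_def by blast
    with c a out[OF a] show ?thesis by (simp add: arc_ingen_outgen)
  qed
  from x out inn show ?thesis by (auto simp: edge_def arc_one_left arc_one_right)
qed

lemma arc_pres_fix: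
  assumes g: "aut g" "arc_pres g" "g v = v" "g w = w" "arc v w" and x: "edge v x"
  shows "g x = x"
proof -
  let ?g = "\<lambda>x. kmul (g (kmul x v)) (kinv v)"
  have 1: "aut ?g" using aut_comp[OF aut_kmul aut_comp[OF g(1) aut_kmul]] .
  have 2: "arc_pres ?g" using arc_pres_comp[OF arc_pres_kmul arc_pres_comp[OF g(2) arc_pres_kmul]] .
  have 3: "?g (0, 0) = (0, 0)" using g by simp
  from g obtain b where b: "b \<noteq> 0" "w = kmul (outgen b) v" by (auto simp: arc_iff)
  have 4: "?g (outgen b) = outgen b" using b(2) g(4) by simp
  have "edge (0, 0) (kmul x (kinv v))" using x edge_kmul[of v "kinv v" x] by simp
  from arc_pres_fix_one[OF 1 2 3 4 b(1) this] have "kmul (g x) (kinv v) = kmul x (kinv v)" by simp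
  then show ?thesis by (metis kmul_kinv_cancel(4))
qed

text \<open>A fixed vertex alone does not fix its neighbours. The property that spreads along edges
  is to be fixed and to have a fixed out-neighbour.\<close>

lemma arc_pres_id:
  assumes g: "aut g" "arc_pres g" "g (0, 0) = (0, 0)" "g (outgen 1) = outgen 1"
  shows "g x = x"
proof -
  let ?F = "\<lambda>v. g v = v \<and> (\<exists>w. arc v w \<and> g w = w)"
  have step: "?F y" if "?F x" "edge x y" for x y
  proof
    from that obtain w where w: "arc x w" "g w = w" "g x = x" by blast
    note fixed = arc_pres_fix[OF g(1,2) w(3,2,1)]
    show "g y = y" using fixed that by blast
    from that(2) consider "arc y x" | "arc x y" by (auto simp: edge_def)
    then show "\<exists>w. arc y w \<and> g w = w"
    proof cases
      case 2
      then obtain a where a: "a \<noteq> 0" "y = kmul (outgen a) x" by (auto simp: arc_iff)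
      \<comment> \<open>The third vertex of a triangle on the arc from \<open>x\<close> to
        \<open>y\<close>: it is a neighbour of \<open>x\<close>, hence fixed, and an out-neighbour
        of \<open>y\<close>.\<close>
      let ?w = "kmul (outgen (h * a)) x"
      have "arc y ?w" using a h_nz by (simp add: arc_outgen_outgen)
      moreover have "arc x ?w" unfolding arc_iff using a h_nz by (intro exI[of _ "h * a"]) simp
      ultimately show ?thesis using fixed[of ?w] unfolding edge_def by blast
    qed (use w in blast)
  qed
  have "arc (0, 0) (outgen 1)" by (auto simp: arc_one_left)
  with g have F: "?F (0, 0)" by blast
  have "?F x" using edge_connected[of "(0, 0)" x]
    by (induction rule: rtranclp_induct) (use F step in blast)+
  then show ?thesis by blast
qed

lemma arc_pres_form:
  assumes g: "aut g" "arc_pres g"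
  shows "\<exists>l k. l \<noteq> 0 \<and> g = (\<lambda>x. kmul (kconj l x) k)"
proof -
  let ?g1 = "\<lambda>x. kmul (g x) (kinv (g (0, 0)))"
  have 1: "aut ?g1" "arc_pres ?g1" "?g1 (0, 0) = (0, 0)"
    using aut_comp[OF aut_kmul g(1)] arc_pres_comp[OF arc_pres_kmul g(2)] by (blast, blast, simp)
  have "arc (0, 0) (outgen 1)" by (auto simp: arc_one_left)
  with 1 have "arc (0, 0) (?g1 (outgen 1))" unfolding arc_pres_def by metis
  then obtain l where l: "l \<noteq> 0" "?g1 (outgen 1) = outgen l" by (auto simp: arc_one_left)
  let ?g2 = "\<lambda>x. kconj (1 / l) (?g1 x)"
  have l': "1 / l \<noteq> 0" using l by simp
  have 2: "aut ?g2" "arc_pres ?g2"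
    using aut_comp[OF aut_kconj[OF l'] 1(1)] arc_pres_comp[OF arc_pres_kconj[OF l'] 1(2)] by blast+
  have "?g2 (0, 0) = (0, 0)" by simp
  moreover have "?g2 (outgen 1) = outgen 1"
    unfolding l(2) using l(1) by (simp add: outgen_def s_div)
  ultimately have id: "?g2 x = x" for x using arc_pres_id[OF 2] by blast
  have "g x = kmul (kconj l x) (g (0, 0))" for x
  proof -
    have "kconj l x = kconj l (?g2 x)" by (simp only: id)
    also have "\<dots> = ?g1 x" using l(1) by simp
    finally show ?thesis by simp
  qed
  with l(1) show ?thesis by blast
qed

section \<open>Exclusion of arc reversal\<close>

lemma arc_rev_inv:
  assumes "aut g" "arc_rev g"
  shows "arc_rev (inv g)"
proof (rule ccontr)
  assume "\<not> arc_rev (inv g)"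
  hence "arc_pres (inv g)" using aut_pres_or_rev[OF aut_inv[OF assms(1)]] by blast
  moreover have "arc (0, 0) (outgen 1)" by (auto simp: arc_one_left)
  ultimately have "arc (g (inv g (outgen 1))) (g (inv g (0, 0)))"
    using assms(2) unfolding arc_pres_def arc_rev_def by blast
  moreover have "g (inv g x) = x" for x
    using assms(1) by (simp add: aut_def bij_def surj_f_inv_f)
  ultimately show False using arc_asym \<open>arc (0, 0) (outgen 1)\<close> by metis
qed

lemma kmul_pow4: "kmul (kmul (kmul (kmul x k) k) k) k = x"
  by (cases x; cases k) (simp add: s_add algebra_simps)

text \<open>Conjugating a translation by \<open>g\<close> gives an arc-preserving map of order dividing 4, and the
  only such maps are translations, because \<open>\<lambda>\<^sup>4 = 1\<close> forces \<open>\<lambda> = 1\<close>.\<close>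

lemma arc_rev_hom:
  assumes g: "aut g" "arc_rev g" "g (0, 0) = (0, 0)"
  shows "g (kmul x k) = kmul (g x) (g k)"
proof -
  have inj: "inj g" and gi: "g (inv g x) = x" for x
    using g by (simp_all add: aut_def bij_def surj_f_inv_f)
  let ?f = "\<lambda>x. g (kmul (inv g x) k)"
  have "aut ?f" using aut_comp[OF g(1) aut_comp[OF aut_kmul aut_inv[OF g(1)]]] .
  moreover have "arc_pres ?f"
    using g(2) arc_rev_inv[OF g(1,2)] unfolding arc_pres_def arc_rev_def by (metis arc_kmul)
  ultimately obtain l m where l: "l \<noteq> 0" "?f = (\<lambda>x. kmul (kconj l x) m)"
    using arc_pres_form by blast
  have f: "?f x = kmul (kconj l x) m" for x using fun_cong[OF l(2)] .
  have f4: "?f (?f (?f (?f x))) = x" for x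
    by (simp only: inv_f_f[OF inj] kmul_pow4 gi)
  have fst: "fst (kmul (kconj l x) m) = l * fst x + fst m" for x
    by (cases x; cases m) simp
  have 4: "l * (l * (l * (l * a + fst m) + fst m) + fst m) + fst m = a" for a
    using arg_cong[OF f4[of "(a, 0)"], of fst] unfolding f fst by simp
  \<comment> \<open>Adding the values at 1 and 0 of the fourth iterate of
    \<open>a \<mapsto> l * a + fst m\<close> cancels the constant term and leaves l^4.\<close>
  have "l * l * (l * l) = (l * (l * (l * (l * 1 + fst m) + fst m) + fst m) + fst m) +
      (l * (l * (l * (l * 0 + fst m) + fst m) + fst m) + fst m)"
    by (simp add: algebra_simps)
  hence "l * l * (l * l) = 1" unfolding 4 by simp
  hence "l = 1" using sq_inj[of "l * l" 1] sq_inj[of l 1] by (simp add: power2_eq_square)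
  have m: "m = g k"
    using f[of "(0, 0)"] inv_f_eq[OF inj g(3)] by simp
  show ?thesis using f[of "g x"] by (simp add: \<open>l = 1\<close> m inv_f_f[OF inj])
qed

lemma not_arc_rev_fixing_one:
  assumes g: "aut g" "arc_rev g" "g (0, 0) = (0, 0)"
  shows False
proof -
  \<comment> \<open>Each \<open>(0, c)\<close> is a square in K, and the additive map
    \<open>P\<close> kills squares; so \<open>P\<close> depends only on the first coordinate and
    induces the additive map \<open>M\<close> below.\<close>
  define P where "P x = fst (g x)" for x
  have P_mul: "P (kmul x y) = P x + P y" for x y
    unfolding P_def arc_rev_hom[OF g] by (cases "g x"; cases "g y") simp
  have P_central: "P (0, c) = 0" for c
  proof -
    obtain d where "s d * d = c" using norm_surj by blast
    hence "(0, c) = kmul (outgen d) (outgen d)" by (simp add: outgen_def)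
    then show ?thesis by (simp add: P_mul del: kmul.simps)
  qed
  have P_out: "P (a, c) = P (outgen a)" for a c
  proof -
    have "(a, c) = kmul (outgen a) (0, c + u * (s a * a))"
      by (simp add: outgen_def algebra_simps)
    then show ?thesis by (simp add: P_mul P_central del: kmul.simps)
  qed
  define M where "M a = P (outgen a)" for a
  have M_add: "M (a + b) = M a + M b" for a b
  proof -
    have "P (a + b, s a * b) = P (a, 0) + P (b, 0)" using P_mul[of "(a, 0)" "(b, 0)"] by simp
    then show ?thesis by (simp only: P_out M_def)
  qed
  have M_out: "\<exists>c. c \<noteq> 0 \<and> g (outgen a) = ingen c" if "a \<noteq> 0" for a
  proof -
    have "arc (0, 0) (outgen a)" using that by (auto simp: arc_one_left)
    hence "arc (g (outgen a)) (0, 0)" using g unfolding arc_rev_def by metis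
    then show ?thesis by (auto simp: arc_one_right)
  qed
  have M_nz: "M a \<noteq> 0" if "a \<noteq> 0" for a
    using M_out[OF that] one_plus_h_nz by (auto simp: M_def P_def ingen_def)
  have M_step: "M a = z * M (h * a)" if "a \<noteq> 0" for a
  proof -
    have "h * a \<noteq> 0" using that h_nz by simp
    with M_out that obtain c d where cd: "c \<noteq> 0" "d \<noteq> 0" "g (outgen a) = ingen c"
      "g (outgen (h * a)) = ingen d" by metis
    have "arc (outgen a) (outgen (h * a))" using that h_nz by (simp add: arc_outgen_outgen)
    hence "arc (g (outgen (h * a))) (g (outgen a))" using g unfolding arc_rev_def by blast
    hence "c = z * d" using cd by (simp add: arc_ingen_ingen)
    then show ?thesis using cd by (simp add: M_def P_def ingen_def)
  qed
  \<comment> \<open>Normalized at 1, the map turns multiplication by \<open>h\<close> into division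
    by \<open>z\<close>. As every nonzero element is a power of \<open>h\<close>, this makes it
    multiplicative.\<close>
  define m where "m a = M a / M 1" for a
  have m_add: "m (a + b) = m a + m b" for a b by (simp add: m_def M_add add_divide_distrib)
  have m_1: "m 1 = 1" using M_nz[of 1] by (simp add: m_def)
  have m_0: "m 0 = 0" using m_add[of 0 0] by simp
  have m_step: "m (h * a) = m a / z" for a
    using M_step[of a] z_nz m_0 by (cases "a = 0") (auto simp: m_def)
  have m_pow: "m (h ^ n * a) = m a / z ^ n" for n a
    by (induction n) (auto simp: m_step mult.assoc)
  have m_mult: "m (a * b) = m a * m b" for a b
  proof (cases "a = 0")
    case False
    then obtain n where "a = h ^ n" using h_prim by blast
    with m_pow[of n b] m_pow[of n 1] show ?thesis by (simp add: m_1)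
  qed (simp add: m_0)
  define w where "w = 1 / h"
  have zw: "z = 1 + w" using h_nz by (simp add: z_def w_def field_simps)
  have m_w: "m w = 1 + w" using m_step[of w] h_nz z_nz by (simp add: w_def m_1 zw)
  have m_z: "m z = w" by (simp add: zw m_add m_1 m_w)
  have m_h: "m h = 1 / z" using m_step[of 1] by (simp add: m_1)
  have "m (1 / z) * m z = 1" using z_nz by (simp add: m_1 flip: m_mult)
  hence m_mh: "m (m h) = h" using h_nz by (simp add: m_h m_z w_def field_simps)
  have mm_pow: "m (m (h ^ n)) = h ^ n" for n
    by (induction n) (simp_all add: m_1 m_mult m_mh)
  have mm: "m (m a) = a" for a
  proof (cases "a = 0")
    case False
    then obtain n where "a = h ^ n" using h_prim by blast
    then show ?thesis using mm_pow by simp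
  qed (simp add: m_0)
  define Fix where "Fix = {a. m a = a}"
  \<comment> \<open>The field has basis 1, \<open>w\<close> over the fixed field of
    \<open>m\<close>: if x = a + b w, then m x = a + b + b w, so b = x + m x and a = x + b
    w.\<close>
  have "bij_betw (\<lambda>(a, b). a + b * w) (Fix \<times> Fix) (UNIV :: 'a set)"
    by (rule bij_betw_byWitness[where f' = "\<lambda>x. (x + (x + m x) * w, x + m x)"])
       (auto simp: Fix_def m_add m_mult mm m_w algebra_simps)
  hence "CARD('a) = card Fix ^ 2"
    by (simp add: bij_betw_same_card[symmetric] card_cartesian_product power2_eq_square)
  with card_nonsquare show False by blast
qed

lemma aut_form:
  assumes g: "aut g"
  shows "\<exists>l k. l \<noteq> 0 \<and> g = (\<lambda>x. kmul (kconj l x) k)"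
proof (cases "arc_rev g")
  case True
  let ?g = "\<lambda>x. kmul (g x) (kinv (g (0, 0)))"
  have "aut ?g" by (rule aut_comp[OF aut_kmul g])
  moreover have "arc_rev ?g" using True by (simp add: arc_rev_def del: split_paired_All)
  ultimately show ?thesis using not_arc_rev_fixing_one[of ?g] by simp
next
  case False
  with aut_pres_or_rev[OF g] arc_pres_form[OF g] show ?thesis by blast
qed

end

section \<open>Matrices\<close>

lemma matrix_inv_eq:
  fixes A B :: "'a::field^'n^'n"
  assumes "A ** B = mat 1" "B ** A = mat 1"
  shows "matrix_inv A = B"
proof -
  have inv: "A ** matrix_inv A = mat 1 \<and> matrix_inv A ** A = mat 1"
    unfolding matrix_inv_def by (rule someI[of _ B]) (use assms in blast)
  have "matrix_inv A = (B ** A) ** matrix_inv A" by (simp add: assms matrix_mul_lid)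
  also have "\<dots> = B" by (simp add: inv matrix_mul_rid flip: matrix_mul_assoc)
  finally show ?thesis .
qed

lemma Phi_eq [simp]: "Phi q0 a c = Phi q0 b d \<longleftrightarrow> a = b \<and> c = d"
proof
  assume eq: "Phi q0 a c = Phi q0 b d"
  have "Phi q0 a c $ 2 $ 1 = a" "Phi q0 a c $ 3 $ 1 = c" for a c :: 'a
    by (simp_all add: Phi_def)
  with eq show "a = b \<and> c = d" by metis
qed simp

section \<open>Arithmetic of the parameters\<close>

locale higman_params =
  fixes f e q0 :: nat and ty :: "'a::{field,finite} itself"
  assumes card: "CARD('a) = 2 ^ f" and f4: "f \<ge> 4" and q0: "q0 = 2 ^ e"
    and gcd: "gcd (CARD('a) - 1) (q0 ^ 2 - 1) = 1"
begin

lemma coprime_dvd: "m dvd q0 ^ 2 - 1 \<Longrightarrow> coprime m (CARD('a) - 1)"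
  using gcd by (metis coprime_iff_gcd_eq_1 coprime_commute coprime_divisors dvd_refl)

lemma one_plus_one: "1 + 1 = (0::'a)"
  by (rule char_two_of_even_card) (use card f4 in simp)

lemma power_q0_add: "(x + y) ^ q0 = x ^ q0 + (y ^ q0 :: 'a)"
  unfolding q0 by (rule frobenius_power_add[OF one_plus_one])

lemma frobenius_like: "frobenius_like (\<lambda>x::'a. x ^ q0)"
proof
  have "q0 ^ 2 - 1 = (q0 + 1) * (q0 - 1)"
    by (simp add: power2_eq_square algebra_simps diff_mult_distrib)
  hence dvd: "q0 + 1 dvd q0 ^ 2 - 1" "q0 - 1 dvd q0 ^ 2 - 1"
    by (simp_all only: dvd_triv_left dvd_triv_right)
  note cop = dvd[THEN coprime_dvd]
  show "1 + 1 = (0::'a)" by (rule one_plus_one)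
  show "(x + y) ^ q0 = x ^ q0 + (y ^ q0 :: 'a)" for x y by (rule power_q0_add)
  show "(x * y) ^ q0 = x ^ q0 * (y ^ q0 :: 'a)" for x y by (rule power_mult_distrib)
  show "x = 0 \<or> x = 1" if "x ^ q0 = x" for x :: 'a
  proof (cases "x = 0")
    case False
    have "q0 = Suc (q0 - 1)" by (simp add: q0)
    hence "x * x ^ (q0 - 1) = x * 1" using that by (metis power_Suc mult_1_right)
    hence "x ^ (q0 - 1) = 1" using False by simp
    from finite_field_power_eq_one[OF cop(2) this False] show ?thesis by simp
  qed simp
  show "\<exists>x. x ^ q0 * x = c" for c :: 'a
    using finite_field_power_surj[OF cop(1), of c] by (simp add: mult.commute)
  show "x = 1" if "x ^ q0 * x = 1" for x :: 'a
    using finite_field_power_inj[OF cop(1), of x 1] that by (simp add: mult.commute)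
qed

lemma coprime_3: "coprime 3 (CARD('a) - 1)"
  using three_dvd_four_power[of e] by (intro coprime_dvd) (simp add: q0 power_mult[symmetric] mult.commute[of _ 2], simp add: power_mult)

lemma odd_f: "odd f"
proof
  assume "even f"
  then obtain k where "f = 2 * k" by blast
  hence "CARD('a) - 1 = 4 ^ k - 1" by (simp add: card power_mult)
  with three_dvd_four_power[of k] coprime_3 show False
    by (metis coprime_absorb_left is_unit_gcd coprime_iff_gcd_eq_1 gcd_nat.absorb1 numeral_eq_one_iff semiring_norm(86))
qed

lemma card_not_square: "CARD('a) \<noteq> m ^ 2"
proof
  assume m: "CARD('a) = m ^ 2"
  hence "m dvd 2 ^ f" by (simp add: card power2_eq_square)
  then obtain k where "m = 2 ^ k" using divides_primepow_nat[OF two_is_prime_nat] by blast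
  hence "(2::nat) ^ f = 2 ^ (k * 2)" using m by (simp add: card power_mult)
  hence "f = k * 2" using power_inject_exp[of "2::nat" f "k * 2"] by simp
  with odd_f show False by simp
qed

lemma frobenius_graph: "frobenius_graph (\<lambda>x::'a. x ^ q0)"
  by (rule frobenius_graph.intro[OF frobenius_like])

lemma frobenius_u:
  fixes u :: 'a
  assumes "u \<in> U_set q0"
  shows "\<exists>h. frobenius_u (\<lambda>x::'a. x ^ q0) u h"
proof -
  from assms obtain h where h: "primitive_elem h" "u = (1 + h ^ q0) / (h + h ^ q0)"
    and root: "\<And>x. x ^ (q0 + 1) + u * x ^ q0 + (u + 1) * x + 1 \<noteq> 0"
    unfolding U_set_def by blast
  have pow: "h ^ m \<noteq> 1" if "m > 0" "m < CARD('a) - 1" for m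
    using primitive_elem_order[OF h(1) _ that(1)] that by auto
  have f5: "f \<ge> 5" using f4 odd_f by (cases "f = 4") auto
  have "(2::nat) ^ 5 \<le> 2 ^ f" by (rule power_increasing[OF f5]) simp
  hence 31: "CARD('a) - 1 \<ge> 31" by (simp add: card)
  \<comment> \<open>For f = 5 the order 31 is less than 63 but coprime to it; f = 6 is even; from f
    = 7 on the order of \<open>h\<close> exceeds 63.\<close>
  have "h ^ 63 \<noteq> 1"
  proof (cases "f = 5")
    case True
    have "coprime (63::nat) 31" by (simp add: coprime_iff_gcd_eq_1 gcd_non_0_nat)
    with True have "h = 1" if "h ^ 63 = 1"
      using finite_field_power_eq_one[of 63 h] that h(1) by (simp add: card primitive_elem_def)
    with pow[of 1] 31 show ?thesis by auto
  next
    case False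
    with f5 odd_f have "f \<ge> 7" by (cases "f = 6") auto
    have "(2::nat) ^ 7 \<le> 2 ^ f" by (rule power_increasing[OF \<open>f \<ge> 7\<close>]) simp
    then show ?thesis by (intro pow) (simp_all add: card)
  qed
  moreover have "h ^ 15 \<noteq> 1" using 31 by (intro pow) simp_all
  moreover have "x = y" if "x ^ 3 = y ^ 3" for x y :: 'a
    using finite_field_power_inj[OF coprime_3 _ that] by simp
  moreover have "x ^ q0 * x + u * x ^ q0 + (u + 1) * x + 1 \<noteq> 0" for x
    using root[of x] by (simp add: mult.commute)
  ultimately have "frobenius_u (\<lambda>x::'a. x ^ q0) u h"
    using h frobenius_graph card_not_square
    unfolding frobenius_u_def frobenius_u_axioms_def primitive_elem_def by blast
  then show ?thesis ..
qed

sublocale frobenius_like "\<lambda>x::'a. x ^ q0"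
  by (rule frobenius_like)

section \<open>Transfer between coordinates and matrices\<close>

lemma Phi_mult: "Phi q0 a c ** Phi q0 b d = Phi q0 (a + b) (c + d + a ^ q0 * b)"
  for a b c d :: 'a
  by (simp add: vec_eq_iff forall_3 sum_3 Phi_def matrix_matrix_mult_def power_q0_add add_ac)

lemma Phi_0 [simp]: "Phi q0 0 0 = (mat 1 :: 'a^3^3)"
  by (simp add: vec_eq_iff forall_3 Phi_def mat_def q0)

definition to_mat :: "'a \<times> 'a \<Rightarrow> 'a^3^3" where
  "to_mat p = Phi q0 (fst p) (snd p)"

lemma to_mat_kmul: "to_mat p ** to_mat r = to_mat (kmul p r)"
  by (cases p; cases r) (simp add: to_mat_def Phi_mult)

lemma to_mat_one: "to_mat (0, 0) = mat 1"
  by (simp add: to_mat_def)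

lemma to_mat_kinv: "matrix_inv (to_mat p) = to_mat (kinv p)"
  by (rule matrix_inv_eq) (simp_all add: to_mat_kmul to_mat_one)

lemma to_mat_eq [simp]: "to_mat p = to_mat r \<longleftrightarrow> p = r"
  by (simp add: to_mat_def prod_eq_iff)

lemma Kgrp_eq: "Kgrp q0 = range to_mat"
  by (auto simp: Kgrp_def to_mat_def image_iff)

lemma Psi_inv: "l \<noteq> 0 \<Longrightarrow> matrix_inv (Psi q0 l) = Psi q0 (1 / l :: 'a)"
  by (rule matrix_inv_eq)
    (simp_all add: vec_eq_iff forall_3 sum_3 Psi_def matrix_matrix_mult_def mat_def power_divide)

lemma to_mat_kconj:
  assumes "l \<noteq> 0"
  shows "matrix_inv (Psi q0 l) ** to_mat p ** Psi q0 l = to_mat (kconj (1 / l) p)"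
proof (cases p)
  case (Pair a c)
  then show ?thesis unfolding Psi_inv[OF assms] using assms
    by (simp add: vec_eq_iff forall_3 sum_3 Psi_def Phi_def to_mat_def matrix_matrix_mult_def
        power_divide field_simps)
qed

text \<open>Extension by the identity outside K matches the convention of both
  \<open>graph_aut\<close> and \<open>G_perm\<close>, so the two can be compared as sets of
  functions.\<close>

definition on_mat :: "('a \<times> 'a \<Rightarrow> 'a \<times> 'a) \<Rightarrow> 'a^3^3 \<Rightarrow> 'a^3^3" where
  "on_mat g X = (if X \<in> Kgrp q0 then to_mat (g (inv to_mat X)) else X)"

lemma inv_to_mat [simp]: "inv to_mat (to_mat p) = p"
  by (rule inv_f_f) (simp add: inj_def)

lemma to_mat_in [simp]: "to_mat p \<in> Kgrp q0"
  by (simp add: Kgrp_eq)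

lemma on_mat [simp]: "on_mat g (to_mat p) = to_mat (g p)"
  by (simp add: on_mat_def)

text \<open>Conjugation by Psi_l divides by \<open>l\<close>, so the parameter is inverted in
  passing to \<open>kconj\<close>; over all nonzero \<open>l\<close> the family is the same.\<close>

lemma G_perm_eq: "G_perm q0 = {on_mat (\<lambda>x. kconj l (kmul x k)) | l k. l \<noteq> 0}"
proof -
  have eq: "(\<lambda>X. if X \<in> Kgrp q0 then matrix_inv (Psi q0 l) ** (X ** to_mat k) ** Psi q0 l else X) =
      on_mat (\<lambda>x. kconj (1 / l) (kmul x k))" if "l \<noteq> 0" for l k
    by (rule ext) (auto simp: on_mat_def Kgrp_eq to_mat_kmul to_mat_kconj[OF that])
  show ?thesis
  proof (intro equalityI subsetI)
    fix \<sigma> :: "'a^3^3 \<Rightarrow> 'a^3^3" assume "\<sigma> \<in> G_perm q0"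
    then obtain l :: 'a and k where "l \<noteq> 0" "\<sigma> = (\<lambda>X. if X \<in> Kgrp q0 then
       matrix_inv (Psi q0 l) ** (X ** to_mat k) ** Psi q0 l else X)"
      by (auto simp: G_perm_def Hgrp_def Kgrp_eq)
    with eq[of l k] show "\<sigma> \<in> {on_mat (\<lambda>x. kconj l (kmul x k)) | l k. l \<noteq> 0}"
      by (intro CollectI exI[of _ "1 / l"] exI[of _ k]) simp
  next
    fix \<sigma> :: "'a^3^3 \<Rightarrow> 'a^3^3" assume "\<sigma> \<in> {on_mat (\<lambda>x. kconj l (kmul x k)) | l k. l \<noteq> 0}"
    then obtain l k where l: "l \<noteq> 0" and \<sigma>: "\<sigma> = on_mat (\<lambda>x. kconj l (kmul x k))" by blast
    from eq[of "1 / l" k] l have "\<sigma> = (\<lambda>X. if X \<in> Kgrp q0 then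
       matrix_inv (Psi q0 (1 / l)) ** (X ** to_mat k) ** Psi q0 (1 / l) else X)"
      by (simp add: \<sigma>)
    moreover have "Psi q0 (1 / l) \<in> Hgrp q0" using l by (auto simp: Hgrp_def)
    ultimately show "\<sigma> \<in> G_perm q0" unfolding G_perm_def using to_mat_in[of k] by blast
  qed
qed

text \<open>In the Cayley convention x y^{-1} in Omega_u is an arc from y to x, and x y^{-1} in
  Omega_{u+1} is one from x to y.\<close>

lemma Gamma_adj_to_mat:
  "Gamma_adj q0 u (to_mat x) (to_mat y) \<longleftrightarrow> frobenius_graph.edge (\<lambda>x. x ^ q0) u x y"
proof -
  interpret frobenius_graph "\<lambda>x. x ^ q0" u by (rule frobenius_graph)
  have Omega: "Omega q0 u = to_mat ` outgen ` (UNIV - {0})"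
    "Omega q0 (u + 1) = to_mat ` (\<lambda>a. kinv (outgen a)) ` (UNIV - {0})"
    by (auto simp: Omega_def to_mat_def outgen_def image_iff algebra_simps)
  have mem: "to_mat p \<in> to_mat ` A \<longleftrightarrow> p \<in> A" for p A by auto
  have "kmul x (kinv y) = p \<longleftrightarrow> x = kmul p y" for p
    by (metis kmul_kinv_cancel(3,4))
  hence "kmul x (kinv y) \<in> outgen ` (UNIV - {0}) \<longleftrightarrow> arc y x"
    unfolding arc_iff by (auto simp: image_iff)
  moreover have "kmul x (kinv y) \<in> (\<lambda>a. kinv (outgen a)) ` (UNIV - {0}) \<longleftrightarrow> arc x y"
  proof -
    have "kmul x (kinv y) = kinv p \<longleftrightarrow> y = kmul p x" for p
      by (metis kmul_kinv_cancel kmul_assoc kmul_one kmul_kinv)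
    then show ?thesis unfolding arc_iff by (auto simp: image_iff)
  qed
  ultimately show ?thesis
    by (auto simp: Gamma_adj_def cay_adj_def to_mat_kinv to_mat_kmul Omega mem edge_def)
qed

lemma Gamma_connected: "graph_connected (Kgrp q0) (Gamma_adj q0 (u :: 'a))"
proof -
  interpret frobenius_graph "\<lambda>x. x ^ q0" u by (rule frobenius_graph)
  have "(to_mat x, to_mat y) \<in> {(a, b). a \<in> Kgrp q0 \<and> b \<in> Kgrp q0 \<and> Gamma_adj q0 u a b}\<^sup>*" for x y
    using edge_connected[of x y]
  proof (induction rule: rtranclp_induct)
    case (step y z)
    then show ?case
      by (intro rtrancl_into_rtrancl[OF step.IH]) (simp add: Gamma_adj_to_mat)
  qed simp
  then show ?thesis by (auto simp: graph_connected_def Kgrp_eq)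
qed

lemma graph_aut_eq:
  "graph_aut (Kgrp q0) (Gamma_adj q0 u) =
    on_mat ` {g. bij g \<and> (\<forall>x y. frobenius_graph.edge (\<lambda>x. x ^ q0) u (g x) (g y) \<longleftrightarrow>
        frobenius_graph.edge (\<lambda>x. x ^ q0) u x y)}" (is "_ = on_mat ` ?A")
proof (intro equalityI subsetI)
  fix \<sigma> :: "'a^3^3 \<Rightarrow> 'a^3^3" assume "\<sigma> \<in> graph_aut (Kgrp q0) (Gamma_adj q0 u)"
  hence bij: "bij_betw \<sigma> (Kgrp q0) (Kgrp q0)" and out: "\<And>X. X \<notin> Kgrp q0 \<Longrightarrow> \<sigma> X = X"
    and adj: "\<And>X Y. X \<in> Kgrp q0 \<Longrightarrow> Y \<in> Kgrp q0 \<Longrightarrow>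
      Gamma_adj q0 u X Y \<longleftrightarrow> Gamma_adj q0 u (\<sigma> X) (\<sigma> Y)"
    by (auto simp: graph_aut_def)
  define g where "g = (\<lambda>p. inv to_mat (\<sigma> (to_mat p)))"
  have g: "to_mat (g p) = \<sigma> (to_mat p)" for p
  proof -
    have "\<sigma> (to_mat p) \<in> range to_mat"
      using bij_betwE[OF bij] by (simp add: Kgrp_eq del: split_paired_All)
    then show ?thesis unfolding g_def by (rule f_inv_into_f)
  qed
  have "inj g"
  proof (rule injI)
    fix x y assume "g x = g y"
    hence "\<sigma> (to_mat x) = \<sigma> (to_mat y)" by (metis g)
    with inj_onD[OF bij_betw_imp_inj_on[OF bij]] show "x = y" by fastforce
  qed
  hence "bij g" by (simp add: bij_def finite_UNIV_inj_surj finite_prod)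
  moreover have "frobenius_graph.edge (\<lambda>x. x ^ q0) u (g x) (g y) \<longleftrightarrow>
        frobenius_graph.edge (\<lambda>x. x ^ q0) u x y" for x y
    using adj[of "to_mat x" "to_mat y"] by (simp add: Gamma_adj_to_mat flip: g)
  moreover have "\<sigma> = on_mat g"
    by (rule ext) (auto simp: on_mat_def out Kgrp_eq g)
  ultimately show "\<sigma> \<in> on_mat ` ?A" by blast
next
  fix \<sigma> :: "'a^3^3 \<Rightarrow> 'a^3^3" assume "\<sigma> \<in> on_mat ` ?A"
  then obtain g where \<sigma>: "\<sigma> = on_mat g" and g: "bij g"
    "\<And>x y. frobenius_graph.edge (\<lambda>x. x ^ q0) u (g x) (g y) \<longleftrightarrow>
        frobenius_graph.edge (\<lambda>x. x ^ q0) u x y" by blast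
  have "bij_betw \<sigma> (Kgrp q0) (Kgrp q0)" unfolding \<sigma>
  proof (rule bij_betw_byWitness[where f' = "on_mat (inv g)"])
    show "\<forall>X\<in>Kgrp q0. on_mat (inv g) (on_mat g X) = X"
      using g(1) by (auto simp: Kgrp_eq bij_def inv_f_f)
    show "\<forall>X\<in>Kgrp q0. on_mat g (on_mat (inv g) X) = X"
      using g(1) by (auto simp: Kgrp_eq bij_def surj_f_inv_f)
  qed (auto simp: Kgrp_eq)
  moreover have "\<sigma> X = X" if "X \<notin> Kgrp q0" for X using that by (simp add: \<sigma> on_mat_def)
  moreover have "Gamma_adj q0 u X Y \<longleftrightarrow> Gamma_adj q0 u (\<sigma> X) (\<sigma> Y)"
    if XY: "X \<in> Kgrp q0" "Y \<in> Kgrp q0" for X Y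
  proof -
    from XY obtain x y where "X = to_mat x" "Y = to_mat y" by (auto simp: Kgrp_eq)
    then show ?thesis by (simp add: \<sigma> Gamma_adj_to_mat g(2))
  qed
  ultimately show "\<sigma> \<in> graph_aut (Kgrp q0) (Gamma_adj q0 u)" by (simp add: graph_aut_def)
qed

lemma graph_aut_eq_G_perm:
  assumes "u \<in> U_set q0"
  shows "graph_aut (Kgrp q0) (Gamma_adj q0 (u :: 'a)) = G_perm q0"
proof -
  obtain h where "frobenius_u (\<lambda>x. x ^ q0) u h" using frobenius_u[OF assms] ..
  then interpret frobenius_u "\<lambda>x. x ^ q0" u h .
  have "aut g \<longleftrightarrow> (\<exists>l k. g = (\<lambda>x. kconj l (kmul x k)) \<and> l \<noteq> 0)" for g
  proof
    assume "aut g"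
    from aut_form[OF this] obtain l k where "l \<noteq> 0" "g = (\<lambda>x. kmul (kconj l x) k)" by blast
    \<comment> \<open>\<open>aut_form\<close> conjugates before translating, G translates before
      conjugating; the exchange replaces \<open>k\<close> by \<open>kconj (1 / l) k\<close>.\<close>
    then show "\<exists>l k. g = (\<lambda>x. kconj l (kmul x k)) \<and> l \<noteq> 0"
      by (intro exI[of _ l] exI[of _ "kconj (1 / l) k"]) (simp add: kconj_kmul)
  next
    assume "\<exists>l k. g = (\<lambda>x. kconj l (kmul x k)) \<and> l \<noteq> 0"
    then show "aut g" using aut_comp[OF aut_kconj aut_kmul] by blast
  qed
  hence "{g. aut g} = {\<lambda>x. kconj l (kmul x k) | l k. l \<noteq> 0}" by auto
  then show ?thesis unfolding graph_aut_eq G_perm_eq aut_def by auto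
qed

text \<open>The given \<open>l\<close> supplies a nontrivial conjugation fixing 1. For uniqueness of
  fixed points, a translation with a fixed point is trivial, and otherwise the quotient of two fixed
  points is fixed by a conjugation whose factors \<open>l\<close> and \<open>l ^ q0 * l\<close> both
  differ from 1, so it is 1.\<close>

lemma frobenius_action_G_perm:
  assumes "(l::'a) \<noteq> 0" "l \<noteq> 1"
  shows "frobenius_action (G_perm q0 :: ('a^3^3 \<Rightarrow> 'a^3^3) set) (Kgrp q0)"
  unfolding frobenius_action_def
proof (intro conjI ballI impI)
  fix X Y :: "'a^3^3" assume "X \<in> Kgrp q0" "Y \<in> Kgrp q0"
  then obtain x y where [simp]: "X = to_mat x" "Y = to_mat y" by (auto simp: Kgrp_eq)
  let ?g = "on_mat (\<lambda>p. kconj 1 (kmul p (kmul (kinv x) y)))"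
  have "?g \<in> G_perm q0" unfolding G_perm_eq using one_neq_zero by blast
  moreover have "?g X = Y" by simp
  ultimately show "\<exists>g\<in>G_perm q0. g X = Y" by blast
next
  let ?g = "on_mat (\<lambda>p. kconj l (kmul p (0, 0)))"
  have "?g \<in> G_perm q0" unfolding G_perm_eq using assms by blast
  moreover have "\<exists>X\<in>Kgrp q0. ?g X \<noteq> X"
    using assms by (intro bexI[of _ "to_mat (1, 0)"]) simp_all
  moreover have "\<exists>X\<in>Kgrp q0. ?g X = X"
    by (intro bexI[of _ "to_mat (0, 0)"]) simp_all
  ultimately show "\<exists>g\<in>G_perm q0 :: ('a^3^3 \<Rightarrow> 'a^3^3) set.
      (\<exists>X\<in>Kgrp q0. g X \<noteq> X) \<and> (\<exists>X\<in>Kgrp q0. g X = X)"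
    by blast
next
  fix g :: "'a^3^3 \<Rightarrow> 'a^3^3"
  assume "g \<in> G_perm q0" and moved: "\<exists>X\<in>Kgrp q0. g X \<noteq> X"
  then obtain l k where l: "l \<noteq> 0" and g: "g = on_mat (\<lambda>x. kconj l (kmul x k))"
    unfolding G_perm_eq by blast
  have unique: "p = p'" if p: "kconj l (kmul p k) = p" and p': "kconj l (kmul p' k) = p'" for p p'
  proof (cases "l = 1")
    case True
    have "k = kmul (kinv p) (kmul p k)" by simp
    also have "\<dots> = (0, 0)" using p True by simp
    finally show ?thesis using moved by (auto simp: g True Kgrp_eq)
  next
    case False
    define r where "r = kmul p (kinv p')"
    have "p = kmul r p'" by (simp add: r_def)
    hence "p = kconj l (kmul (kmul r p') k)" using p by simp
    also have "\<dots> = kmul (kconj l r) p'"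
      unfolding kmul_assoc kconj_kmul[of l r] p' ..
    finally have "kmul r p' = kmul (kconj l r) p'" using \<open>p = kmul r p'\<close> by simp
    hence r: "r = kconj l r" by (metis kmul_kinv_cancel(3))
    have norm: "l ^ q0 * l \<noteq> 1" using norm_inj False by blast
    have "r = (0, 0)"
    proof (cases r)
      case (Pair a c)
      from r have *: "a = l * a \<and> c = l ^ q0 * l * c"
        unfolding Pair kconj.simps prod.inject .
      have "a = 0" "c = 0" using * False norm mult_cancel_right1 by blast+
      with Pair show ?thesis by simp
    qed
    with \<open>p = kmul r p'\<close> show ?thesis by simp
  qed
  have "X = Y" if "X \<in> {X \<in> Kgrp q0. g X = X}" "Y \<in> {X \<in> Kgrp q0. g X = X}" for X Y
    using that unique by (auto simp: Kgrp_eq g)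
  then show "card {X \<in> Kgrp q0. g X = X} \<le> 1"
    by (simp add: card_le_Suc0_iff_eq)
qed

end

theorem theorem3p1:
  fixes f e :: nat and q0 :: nat
  assumes "CARD('a::{field,finite}) = 2 ^ f" and "f \<ge> 4"
    and "q0 = 2 ^ e" and "q0 < CARD('a)"
    and "gcd (CARD('a) - 1) (q0 ^ 2 - 1) = 1"
  shows "(\<forall>u::'a. graph_connected (Kgrp q0) (Gamma_adj q0 u)) \<and>
         (\<forall>u::'a. u \<in> U_set q0 \<longrightarrow>
            graph_aut (Kgrp q0) (Gamma_adj q0 u) = G_perm q0 \<and>
            frobenius_action (G_perm q0 :: ('a^3^3 \<Rightarrow> 'a^3^3) set) (Kgrp q0))"
proof -
  interpret higman_params f e q0 "TYPE('a)"
    using assms by unfold_locales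
  have "frobenius_action (G_perm q0 :: ('a^3^3 \<Rightarrow> 'a^3^3) set) (Kgrp q0)" if u: "u \<in> U_set q0" for u :: 'a
  proof -
    obtain h where "frobenius_u (\<lambda>x. x ^ q0) u h" using frobenius_u[OF u] ..
    then interpret frobenius_u "\<lambda>x. x ^ q0" u h .
    show ?thesis using frobenius_action_G_perm[OF h_nz h_ne_1] .
  qed
  with Gamma_connected graph_aut_eq_G_perm show ?thesis by blast
qed

end
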